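(* Let $n\ge 2$ be an integer and consider the anisotropic Heisenberg group $\mathbb{H}_{2n}(\tfrac12,1)$ on $\mathbb{R}^{2n+1}$ with its sub-Laplacian $\Delta=\sum_{j=1}^{2n}X_j^2$ and homogeneous dimension $Q=2n+2$. Define, for $(x,t)\in\mathbb{R}^{2n}\times\mathbb{R}$, $(x,t)\neq(0,0)$, $$N(x,t)=\frac{\left(B^{2}+t^{2}\right)^{\frac{1}{4n}}\left(AB+t^{2}+A\sqrt{B^{2}+t^{2}}\right)^{\frac{1}{2}-\frac{1}{4n}}}{\left(B+\sqrt{B^{2}+t^{2}}\right)^{\frac{1}{2}}},$$ and $N(0,0)=0$, where $$A=\frac{x_1^2}{2}+\frac{x_{n+1}^2}{2}+\frac12\sum_{\substack{2\le j\le 2n\\ j\ne n+1}}x_j^2,\qquad B=\frac{x_1^2}{4}+\frac{x_{n+1}^2}{4}+\frac12\sum_{\substack{2\le j\le 2n\\ j\ne n+1}}x_j^2 .$$ Then $N$ is a homogeneous norm and, up to a multiplicative constant, $N^{2-Q}=N^{-2n}$ is the fundamental solution of $\Delta$ with singularity at the origin; that is, there is a nonzero constant $c$ such that $\Delta\left(c\,N^{-2n}\right)=\delta_0$ in the sense of distributions on $\mathbb{R}^{2n+1}$.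
   Context: The group $\mathbb{H}_{2n}(\tfrac12,1)$ is $\mathbb{R}^{2n+1}$ with points $(x,t)=(x_1,\dots,x_{2n},t)$, dilations $\delta_\lambda(x,t)=(\lambda x,\lambda^2 t)$ and group law $$(x,t)\circ(\eta,\tau)=\Big(x+\eta,\ t+\tau+\tfrac{x_1\eta_{n+1}}{2}-\tfrac{x_{n+1}\eta_1}{2}+\sum_{j=2}^n (x_j\eta_{j+n}-\eta_j x_{j+n})\Big).$$ Its generators are the vector fields $X_1=\partial_{x_1}-\frac{x_{n+1}}{2}\partial_t$, $X_{n+1}=\partial_{x_{n+1}}+\frac{x_1}{2}\partial_t$, $X_j=\partial_{x_j}-x_{j+n}\partial_t$ for $j=2,\dots,n$, and $X_j=\partial_{x_j}+x_{j-n}\partial_t$ for $j=n+2,\dots,2n$. The sub-Laplacian is $\Delta=\sum_{j=1}^{2n}X_j^2$. A homogeneous norm is a continuous function $N:\mathbb{R}^{2n+1}\to[0,\infty)$ with $N(\delta_\lambda(x,t))=\lambda N(x,t)$ for $\lambda>0$, and $N(x,t)=0$ if and only if $(x,t)=(0,0)$. $\delta_0$ denotes the Dirac distribution at the origin. *)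

theory Defs
  imports "HOL-Analysis.Analysis"
begin

section \<open>Test functions and distributions on a Euclidean space\<close>

text \<open>
  A function is \<open>C\<^sup>k\<close> if all its iterated directional derivatives up to order \<open>k\<close>
  exist (as Frechet derivatives) and are continuous.
\<close>

fun Ck :: "nat \<Rightarrow> ('a::euclidean_space \<Rightarrow> real) \<Rightarrow> bool" where
  "Ck 0 f \<longleftrightarrow> continuous_on UNIV f"
| "Ck (Suc k) f \<longleftrightarrow>
     (\<forall>p. f differentiable (at p)) \<and> (\<forall>v. Ck k (\<lambda>p. frechet_derivative f (at p) v))"

definition smooth :: "('a::euclidean_space \<Rightarrow> real) \<Rightarrow> bool" where
  "smooth f \<longleftrightarrow> (\<forall>k. Ck k f)"

definition test_functions :: "('a::euclidean_space \<Rightarrow> real) set" where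
  "test_functions = {\<phi>. smooth \<phi> \<and> compact (closure {p. \<phi> p \<noteq> 0})}"

definition locally_integrable :: "('a::euclidean_space \<Rightarrow> real) \<Rightarrow> bool" where
  "locally_integrable f \<longleftrightarrow> (\<forall>K. compact K \<longrightarrow> set_integrable lborel K f)"

text \<open>
  Distributions are represented as functionals on all functions; only their values on
  test functions are meaningful, so equality of distributions is equality on
  \<^const>\<open>test_functions\<close>.
\<close>

type_synonym 'a functional = "('a \<Rightarrow> real) \<Rightarrow> real"

definition dist_of :: "('a::euclidean_space \<Rightarrow> real) \<Rightarrow> 'a functional" where
  "dist_of f = (\<lambda>\<phi>. \<integral>p. f p * \<phi> p \<partial>lborel)"

definition dirac :: "'a::euclidean_space \<Rightarrow> 'a functional" where
  "dirac a = (\<lambda>\<phi>. \<phi> a)"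

definition dist_partial :: "'a::euclidean_space \<Rightarrow> 'a functional \<Rightarrow> 'a functional" where
  "dist_partial v T = (\<lambda>\<phi>. - T (\<lambda>p. frechet_derivative \<phi> (at p) v))"

definition dist_mult :: "('a::euclidean_space \<Rightarrow> real) \<Rightarrow> 'a functional \<Rightarrow> 'a functional" where
  "dist_mult a T = (\<lambda>\<phi>. T (\<lambda>p. a p * \<phi> p))"

text \<open>
  The action of a smooth vector field \<open>V = \<Sum>\<^sub>b V\<^sub>b \<partial>\<^sub>b\<close> on a distribution, the sum ranging
  over the standard basis.
\<close>

definition dist_field :: "('a::euclidean_space \<Rightarrow> 'a) \<Rightarrow> 'a functional \<Rightarrow> 'a functional" where
  "dist_field V T = (\<lambda>\<phi>. \<Sum>b\<in>Basis. dist_mult (\<lambda>p. V p \<bullet> b) (dist_partial b T) \<phi>)"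


section \<open>The anisotropic Heisenberg group\<close>

text \<open>
  The underlying space is \<open>(real ^ 'm) \<times> real\<close>, where \<open>'m\<close> is an index type with \<open>2 n\<close>
  elements. The parameter \<open>e\<close>, assumed to be a bijection from \<open>{1..2 * n}\<close> onto \<open>'m\<close>,
  enumerates the coordinates: the coordinate \<open>x\<^sub>j\<close> of the point \<open>(x, t)\<close> is \<open>x $ e j\<close>.
\<close>

definition heis_mult ::
  "nat \<Rightarrow> (nat \<Rightarrow> 'm::finite) \<Rightarrow> (real ^ 'm) \<times> real \<Rightarrow> (real ^ 'm) \<times> real \<Rightarrow> (real ^ 'm) \<times> real"
where
  "heis_mult n e p q =
     (let x = fst p; t = snd p; \<eta> = fst q; \<tau> = snd q in
      (x + \<eta>,
       t + \<tau> + x $ e 1 * \<eta> $ e (n + 1) / 2 - x $ e (n + 1) * \<eta> $ e 1 / 2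
         + (\<Sum>j = 2..n. x $ e j * \<eta> $ e (j + n) - \<eta> $ e j * x $ e (j + n))))"

definition heis_dilation :: "real \<Rightarrow> (real ^ 'm) \<times> real \<Rightarrow> (real ^ 'm) \<times> real" where
  "heis_dilation l p = (l *\<^sub>R fst p, l\<^sup>2 * snd p)"

definition heis_X ::
  "nat \<Rightarrow> (nat \<Rightarrow> 'm::finite) \<Rightarrow> nat \<Rightarrow> (real ^ 'm) \<times> real \<Rightarrow> (real ^ 'm) \<times> real"
where
  "heis_X n e j p =
     (axis (e j) 1,
      if j = 1 then - (fst p $ e (n + 1)) / 2
      else if j = n + 1 then fst p $ e 1 / 2
      else if j \<le> n then - (fst p $ e (j + n))
      else fst p $ e (j - n))"

text \<open>The vector fields are the left-invariant ones extending the coordinate directions.\<close>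

lemma heis_X_left_invariant:
  fixes e :: "nat \<Rightarrow> 'm::finite"
  assumes n: "1 \<le> n" and e: "bij_betw e {1..2 * n} UNIV" and j: "j \<in> {1..2 * n}"
  shows "((\<lambda>s. heis_mult n e p (s *\<^sub>R axis (e j) 1, 0)) has_vector_derivative heis_X n e j p) (at 0)"
proof -
  have inj: "e i = e k \<longleftrightarrow> i = k" if "i \<in> {1..2 * n}" "k \<in> {1..2 * n}" for i k
    using bij_betw_imp_inj_on[OF e] that by (rule inj_on_eq_iff)
  define x where "x = fst p"
  define a :: "real ^ 'm" where "a = axis (e j) 1"
  have ax: "a $ e i = (if i = j then 1 else 0)" if "i \<in> {1..2 * n}" for i
    using inj[OF that j] by (auto simp: axis_def a_def)
  define S where "S = (\<Sum>i = 2..n. x $ e i * a $ e (i + n) - a $ e i * x $ e (i + n))"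
  have S: "S = (if n + 2 \<le> j then x $ e (j - n) else if 2 \<le> j \<and> j \<le> n then - (x $ e (j + n)) else 0)"
  proof -
    have "S = (\<Sum>i = 2..n. (if i = j - n then (if n \<le> j then x $ e i else 0) else 0)
              - (if i = j then x $ e (i + n) else 0))"
      unfolding S_def
    proof (rule sum.cong)
      fix i assume i: "i \<in> {2..n}"
      then have "a $ e i = (if i = j then 1 else 0)" "a $ e (i + n) = (if i + n = j then 1 else 0)"
        using ax[of i] ax[of "i + n"] by auto
      then show "x $ e i * a $ e (i + n) - a $ e i * x $ e (i + n) =
          (if i = j - n then (if n \<le> j then x $ e i else 0) else 0)
            - (if i = j then x $ e (i + n) else 0)"
        using i by (cases "i + n = j"; cases "i = j") auto
    qed simp
    also have "\<dots> = (\<Sum>i = 2..n. if i = j - n then (if n \<le> j then x $ e i else 0) else 0)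
              - (\<Sum>i = 2..n. if i = j then x $ e (i + n) else 0)"
      by (rule sum_subtractf)
    also have "\<dots> = (if n + 2 \<le> j then x $ e (j - n)
                        else if 2 \<le> j \<and> j \<le> n then - (x $ e (j + n)) else 0)"
      using j n unfolding sum.delta[OF finite_atLeastAtMost] by auto
    finally show ?thesis .
  qed
  have "heis_mult n e p (s *\<^sub>R a, 0) = p + s *\<^sub>R heis_X n e j p" for s
  proof (rule prod_eqI)
    show "fst (heis_mult n e p (s *\<^sub>R a, 0)) = fst (p + s *\<^sub>R heis_X n e j p)"
      by (simp add: heis_mult_def heis_X_def a_def Let_def)
    have "(\<Sum>i = 2..n. x $ e i * (s *\<^sub>R a) $ e (i + n) - (s *\<^sub>R a) $ e i * x $ e (i + n)) = s * S"
      unfolding S_def sum_distrib_left by (rule sum.cong) (auto simp: algebra_simps)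
    then have "snd (heis_mult n e p (s *\<^sub>R a, 0)) =
        snd p + s * (x $ e 1 * a $ e (n + 1) / 2 - x $ e (n + 1) * a $ e 1 / 2 + S)"
      by (simp add: heis_mult_def Let_def x_def algebra_simps)
    also have "x $ e 1 * a $ e (n + 1) / 2 - x $ e (n + 1) * a $ e 1 / 2 + S = snd (heis_X n e j p)"
    proof -
      have a1: "a $ e 1 = (if j = 1 then 1 else 0)" "a $ e (n + 1) = (if j = n + 1 then 1 else 0)"
        using n ax[of 1] ax[of "n + 1"] by auto
      consider "j = 1" | "j = n + 1" | "2 \<le> j" "j \<le> n" | "n + 2 \<le> j"
        using j unfolding atLeastAtMost_iff by linarith
      then show ?thesis
        by cases (use n in \<open>simp_all add: a1[simplified] S heis_X_def x_def\<close>)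
    qed
    finally show "snd (heis_mult n e p (s *\<^sub>R a, 0)) = snd (p + s *\<^sub>R heis_X n e j p)"
      by simp
  qed
  then have "(\<lambda>s. heis_mult n e p (s *\<^sub>R a, 0)) = (\<lambda>s. p + s *\<^sub>R heis_X n e j p)"
    by (rule ext)
  moreover have "((\<lambda>s. p + s *\<^sub>R heis_X n e j p) has_vector_derivative heis_X n e j p) (at 0)"
    by (rule derivative_eq_intros | simp)+
  ultimately show ?thesis
    by (simp add: a_def)
qed

definition sub_laplacian ::
  "nat \<Rightarrow> (nat \<Rightarrow> 'm::finite) \<Rightarrow> ((real ^ 'm) \<times> real) functional \<Rightarrow> ((real ^ 'm) \<times> real) functional"
where
  "sub_laplacian n e T =
     (\<lambda>\<phi>. \<Sum>j = 1..2 * n. dist_field (heis_X n e j) (dist_field (heis_X n e j) T) \<phi>)"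

definition hom_dim :: "nat \<Rightarrow> nat" where
  "hom_dim n = 2 * n + 2"

definition homogeneous_norm :: "((real ^ 'm::finite) \<times> real \<Rightarrow> real) \<Rightarrow> bool" where
  "homogeneous_norm N \<longleftrightarrow>
     continuous_on UNIV N \<and> (\<forall>p. 0 \<le> N p) \<and>
     (\<forall>l > 0. \<forall>p. N (heis_dilation l p) = l * N p) \<and>
     (\<forall>p. N p = 0 \<longleftrightarrow> p = 0)"

definition heis_A :: "nat \<Rightarrow> (nat \<Rightarrow> 'm::finite) \<Rightarrow> real ^ 'm \<Rightarrow> real" where
  "heis_A n e x = (x $ e 1)\<^sup>2 / 2 + (x $ e (n + 1))\<^sup>2 / 2
     + 1 / 2 * (\<Sum>j\<in>{2..2 * n} - {n + 1}. (x $ e j)\<^sup>2)"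

definition heis_B :: "nat \<Rightarrow> (nat \<Rightarrow> 'm::finite) \<Rightarrow> real ^ 'm \<Rightarrow> real" where
  "heis_B n e x = (x $ e 1)\<^sup>2 / 4 + (x $ e (n + 1))\<^sup>2 / 4
     + 1 / 2 * (\<Sum>j\<in>{2..2 * n} - {n + 1}. (x $ e j)\<^sup>2)"

definition heis_N :: "nat \<Rightarrow> (nat \<Rightarrow> 'm::finite) \<Rightarrow> (real ^ 'm) \<times> real \<Rightarrow> real" where
  "heis_N n e p =
     (if p = 0 then 0 else
      let A = heis_A n e (fst p); B = heis_B n e (fst p); t = snd p in
      (B\<^sup>2 + t\<^sup>2) powr (1 / (4 * real n))
        * (A * B + t\<^sup>2 + A * sqrt (B\<^sup>2 + t\<^sup>2)) powr (1 / 2 - 1 / (4 * real n))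
        / (B + sqrt (B\<^sup>2 + t\<^sup>2)) powr (1 / 2))"

end

theory Submission
  imports Defs
begin

text \<open>
  With \<open>a = A - B\<close>, \<open>r = sqrt (B\<^sup>2 + t\<^sup>2)\<close> and \<open>s = n - 1 / 2\<close> one has
  \<open>A B + t\<^sup>2 + A r = (B + r) (a + r)\<close>, so the candidate \<open>G\<close>, the power of \<open>N\<close> with
  exponent \<open>-2 n\<close>, is \<open>h (a + r) powr (- s)\<close> with \<open>h = sqrt (B + r) / r\<close>.
  On functions of \<open>(a, B, t)\<close> the sub-Laplacian acts as a second-order operator in these variables,
  which annihilates \<open>G\<close>. Replacing \<open>B\<close> by \<open>B + \<epsilon>\<close> gives smooth functions \<open>G\<^sub>\<epsilon>\<close>, and only the
  explicit dependence of that operator on \<open>B\<close> is left over: the sub-Laplacian of \<open>G\<^sub>\<epsilon>\<close> is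
  \<open>- 2 \<epsilon> s (s + 1) h\<^sub>\<epsilon> (a + r\<^sub>\<epsilon>) powr (- s - 2)\<close>. This has one sign, is integrable, and its total mass
  is independent of \<open>\<epsilon>\<close> by dilation invariance, so it converges to a nonzero multiple of the Dirac
  distribution as \<open>\<epsilon>\<close> tends to \<open>0\<close>. Integration by parts against \<open>G\<^sub>\<epsilon>\<close> and dominated convergence conclude.
\<close>

text \<open>The obstacle is the singularity at the origin. For \<open>\<epsilon> > 0\<close> the
  function \<open>reg_G n e \<epsilon>\<close> is smooth on the whole space, so integration by parts
  leaves no boundary terms around the origin. Write \<Gamma> for \<open>carre\<close>. On the group,
  \<Gamma>(B, B) = \<Gamma>(t, t) = 2 B - a and \<Gamma>(B, t) = 0, so on functions of (B, t) the
  second-order part is a multiple of the flat Laplacian of that plane. Up to the factor sqrt 2, h is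
  the real part of (B + i t) to the power -1/2, hence harmonic there. Shifting B changes none of its
  derivatives; only the coefficient 2 B - a, rewritten in the shifted variable, acquires the term -2
  \<epsilon>. The sub-Laplacian of the candidate is affine in this coefficient, which explains the
  single error term. The number 2 s = 2 n - 1 is the sub-Laplacian of B. Both integrability results
  rest on h \<le> sqrt 2 times r to the power -1/2: the candidate is bounded by a function of degree
  -2 n, and the error density for \<open>\<epsilon> = 1\<close> decays with degree -2 n - 4, on the
  two sides of the critical degree -Q = -2 n - 2.\<close>

section \<open>Smooth functions\<close>

text \<open>Uniqueness of the derivative allows an explicit formula in place of
  \<open>frechet_derivative\<close>, so that the inductions over \<open>k\<close> below can work
  with product and chain rules.\<close>

lemma Ck_SucI:
  assumes "\<And>p. (f has_derivative f' p) (at p)" "\<And>v. Ck k (\<lambda>p. f' p v)"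
  shows "Ck (Suc k) f"
proof -
  have "frechet_derivative f (at p) = f' p" for p
    using frechet_derivative_at[OF assms(1)] by simp
  then show ?thesis
    using assms by (auto simp: differentiable_def)
qed

lemma Ck_SucD:
  assumes "Ck (Suc k) f"
  shows "(f has_derivative frechet_derivative f (at p)) (at p)"
    and "Ck k (\<lambda>p. frechet_derivative f (at p) v)"
  using assms by (auto simp flip: frechet_derivative_works)

text \<open>Product and chain rules leave undifferentiated factors, for which an induction over
  \<open>k\<close> must give up one order.\<close>

lemma Ck_Suc_imp: "Ck (Suc k) f \<Longrightarrow> Ck k f"
proof (induction k arbitrary: f)
  case 0
  then have "f differentiable (at p)" for p by simp
  then show ?case
    by (simp add: continuous_at_imp_continuous_on differentiable_imp_continuous_within)
next
  case (Suc k)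
  then show ?case by (metis Ck.simps(2))
qed

lemma Ck_const: "Ck k (\<lambda>p. c)"
proof (induction k arbitrary: c)
  case (Suc k)
  show ?case by (rule Ck_SucI[where f' = "\<lambda>_ _. 0"]) (use Suc in \<open>auto intro: derivative_eq_intros\<close>)
qed simp

lemma Ck_linear: "bounded_linear f \<Longrightarrow> Ck k f"
proof (cases k)
  case 0
  then show "bounded_linear f \<Longrightarrow> Ck k f"
    by (simp add: linear_continuous_on)
next
  case (Suc l)
  show "bounded_linear f \<Longrightarrow> Ck k f"
    unfolding Suc
    by (rule Ck_SucI[where f' = "\<lambda>_. f"]) (auto intro: Ck_const bounded_linear_imp_has_derivative)
qed

lemma Ck_add: "Ck k f \<Longrightarrow> Ck k g \<Longrightarrow> Ck k (\<lambda>p. f p + g p)"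
proof (induction k arbitrary: f g)
  case 0
  then show ?case by (auto intro: continuous_intros)
next
  case (Suc k)
  show ?case
    by (rule Ck_SucI[OF has_derivative_add[OF Ck_SucD(1)[OF Suc.prems(1)] Ck_SucD(1)[OF Suc.prems(2)]]])
      (intro Suc.IH Ck_SucD(2)[OF Suc.prems(1)] Ck_SucD(2)[OF Suc.prems(2)])
qed

lemma Ck_mult: "Ck k f \<Longrightarrow> Ck k g \<Longrightarrow> Ck k (\<lambda>p. f p * g p)"
proof (induction k arbitrary: f g)
  case 0
  then show ?case by (auto intro: continuous_intros)
next
  case (Suc k)
  show ?case
    by (rule Ck_SucI[OF has_derivative_mult[OF Ck_SucD(1)[OF Suc.prems(1)] Ck_SucD(1)[OF Suc.prems(2)]]])
      (intro Ck_add Suc.IH Ck_SucD(2)[OF Suc.prems(1)] Ck_SucD(2)[OF Suc.prems(2)]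
         Ck_Suc_imp[OF Suc.prems(1)] Ck_Suc_imp[OF Suc.prems(2)])
qed

lemma has_derivative_powr_const:
  assumes "(f has_derivative f') (at p)" "f p > 0"
  shows "((\<lambda>p. f p powr c :: real) has_derivative (\<lambda>v. c * f p powr (c - 1) * f' v)) (at p)"
  using has_derivative_powr[OF assms(1) has_derivative_const assms(2), of c]
  by (rule has_derivative_eq_rhs) (use assms(2) in \<open>auto simp: powr_diff\<close>)

text \<open>The induction is over all exponents at once because differentiation lowers the exponent
  by one; positivity keeps every real exponent admissible.\<close>

lemma Ck_powr: "Ck k f \<Longrightarrow> (\<And>p. f p > 0) \<Longrightarrow> Ck k (\<lambda>p. f p powr c)"
proof (induction k arbitrary: c)
  case 0
  then show ?case
    unfolding Ck.simps by (intro continuous_on_powr continuous_on_const ballI) (metis less_irrefl)+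
next
  case (Suc k)
  have "Ck k (\<lambda>p. c * f p powr (c - 1) * frechet_derivative f (at p) v)" for v
    by (intro Ck_mult Ck_const Suc.IH Ck_SucD(2)[OF Suc.prems(1)] Ck_Suc_imp[OF Suc.prems(1)] Suc.prems(2))
  then show ?case
    by (rule Ck_SucI[OF has_derivative_powr_const[OF Ck_SucD(1)[OF Suc.prems(1)] Suc.prems(2)]])
qed

lemma smooth_const: "smooth (\<lambda>p. c)"
  and smooth_linear: "bounded_linear f \<Longrightarrow> smooth f"
  and smooth_add: "smooth f \<Longrightarrow> smooth g \<Longrightarrow> smooth (\<lambda>p. f p + g p)"
  and smooth_mult: "smooth f \<Longrightarrow> smooth g \<Longrightarrow> smooth (\<lambda>p. f p * g p)"
  and smooth_powr: "smooth f \<Longrightarrow> (\<And>p. f p > 0) \<Longrightarrow> smooth (\<lambda>p. f p powr c)"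
  by (auto simp: smooth_def Ck_const Ck_linear Ck_add Ck_mult Ck_powr)

lemma smooth_sum: "(\<And>i. i \<in> I \<Longrightarrow> smooth (f i)) \<Longrightarrow> smooth (\<lambda>p. \<Sum>i\<in>I. f i p)"
  by (induction I rule: infinite_finite_induct) (auto intro: smooth_const smooth_add)

lemma smooth_power: "smooth f \<Longrightarrow> smooth (\<lambda>p. f p ^ k)"
  by (induction k) (auto intro: smooth_const smooth_mult)

lemma smooth_directional: "smooth f \<Longrightarrow> smooth (\<lambda>p. frechet_derivative f (at p) v)"
  by (metis Ck_SucD(2) smooth_def)

lemma smooth_has_derivative: "smooth f \<Longrightarrow> (f has_derivative frechet_derivative f (at p)) (at p)"
  by (metis Ck_SucD(1) smooth_def)

lemma smooth_continuous: "smooth f \<Longrightarrow> continuous_on A f"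
  by (metis Ck.simps(1) smooth_def continuous_on_subset subset_UNIV)

lemma frechet_derivative_mult:
  fixes f g :: "'a::euclidean_space \<Rightarrow> real"
  assumes "smooth f" "smooth g"
  shows "frechet_derivative (\<lambda>p. f p * g p) (at p) v =
    f p * frechet_derivative g (at p) v + frechet_derivative f (at p) v * g p"
  using frechet_derivative_at[OF has_derivative_mult[OF smooth_has_derivative[OF assms(1)]
        smooth_has_derivative[OF assms(2)]], of p] by metis

lemma frechet_derivative_add:
  fixes f g :: "'a::euclidean_space \<Rightarrow> real"
  assumes "smooth f" "smooth g"
  shows "frechet_derivative (\<lambda>p. f p + g p) (at p) v =
    frechet_derivative f (at p) v + frechet_derivative g (at p) v"
  using frechet_derivative_at[OF has_derivative_add[OF smooth_has_derivative[OF assms(1)]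
        smooth_has_derivative[OF assms(2)]], of p] by metis

section \<open>Test functions\<close>

lemma test_functionD:
  assumes "\<phi> \<in> test_functions"
  shows "smooth \<phi>" "compact (closure {p. \<phi> p \<noteq> 0})"
  using assms by (auto simp: test_functions_def)

text \<open>The vanishing condition concerns the complement of the closed support, not the zero set:
  a derivative of \<open>\<phi>\<close> may be nonzero at a point where \<open>\<phi>\<close>
  vanishes.\<close>

lemma test_functionI:
  fixes \<phi> \<psi> :: "'a::euclidean_space \<Rightarrow> real"
  assumes "smooth \<psi>" "\<phi> \<in> test_functions"
    and "\<And>p. p \<notin> closure {p. \<phi> p \<noteq> 0} \<Longrightarrow> \<psi> p = 0"
  shows "\<psi> \<in> test_functions"
proof -
  have "{p. \<psi> p \<noteq> 0} \<subseteq> closure {p. \<phi> p \<noteq> 0}" using assms(3) by auto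
  then have "closure {p. \<psi> p \<noteq> 0} \<subseteq> closure {p. \<phi> p \<noteq> 0}"
    by (simp add: closure_minimal)
  then have "compact (closure {p. \<psi> p \<noteq> 0})"
    using test_functionD(2)[OF assms(2)]
    by (metis closed_closure compact_Int_closed inf.absorb_iff2)
  then show ?thesis using assms(1) by (simp add: test_functions_def)
qed

lemma not_closure_zero: "p \<notin> closure {p. \<phi> p \<noteq> (0::real)} \<Longrightarrow> \<phi> p = 0"
  using closure_subset[of "{p. \<phi> p \<noteq> 0}"] by blast

lemma test_mult: "\<phi> \<in> test_functions \<Longrightarrow> smooth f \<Longrightarrow> (\<lambda>p. f p * \<phi> p) \<in> test_functions"
proof (rule test_functionI[OF smooth_mult[OF _ test_functionD(1)]])
  fix p
  show "f p * \<phi> p = 0" if "p \<notin> closure {p. \<phi> p \<noteq> 0}"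
    using not_closure_zero[OF that] by simp
qed

lemma test_sum:
  fixes f :: "'i \<Rightarrow> 'a::euclidean_space \<Rightarrow> real"
  assumes "finite I" "\<And>i. i \<in> I \<Longrightarrow> f i \<in> test_functions"
  shows "(\<lambda>p. \<Sum>i\<in>I. f i p) \<in> test_functions"
proof -
  have "{p. (\<Sum>i\<in>I. f i p) \<noteq> 0} \<subseteq> (\<Union>i\<in>I. {p. f i p \<noteq> 0})"
    by (auto intro: sum.neutral)
  also have "\<dots> \<subseteq> (\<Union>i\<in>I. closure {p. f i p \<noteq> 0})"
    by (intro UN_mono closure_subset) auto
  finally have "closure {p. (\<Sum>i\<in>I. f i p) \<noteq> 0} \<subseteq> (\<Union>i\<in>I. closure {p. f i p \<noteq> 0})"
    using assms(1) by (intro closure_minimal closed_UN) auto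
  moreover have "compact (\<Union>i\<in>I. closure {p. f i p \<noteq> 0})"
    by (rule compact_UN[OF assms(1)]) (use assms(2) test_functionD(2) in blast)
  ultimately have "compact (closure {p. (\<Sum>i\<in>I. f i p) \<noteq> 0})"
    by (metis closed_closure compact_Int_closed inf.absorb_iff2)
  then show ?thesis
    unfolding test_functions_def using smooth_sum[of I f] test_functionD(1)[OF assms(2)] by blast
qed

lemma test_directional:
  fixes \<phi> :: "'a::euclidean_space \<Rightarrow> real"
  assumes "\<phi> \<in> test_functions"
  shows "(\<lambda>p. frechet_derivative \<phi> (at p) v) \<in> test_functions"
proof (rule test_functionI[OF smooth_directional[OF test_functionD(1)[OF assms]] assms])
  fix p assume p: "p \<notin> closure {p. \<phi> p \<noteq> 0}"
  have "(\<phi> has_derivative (\<lambda>_. 0)) (at p)"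
    by (rule has_derivative_transform_within_open[of "\<lambda>_. 0" _ _ _ "- closure {p. \<phi> p \<noteq> 0}"])
      (use p not_closure_zero[of _ \<phi>, symmetric] in
        \<open>simp_all only: has_derivative_const open_Compl closed_closure Compl_iff not_False_eq_True\<close>)
  then show "frechet_derivative \<phi> (at p) v = 0"
    using frechet_derivative_at by metis
qed

lemma test_bounded:
  fixes \<phi> :: "'a::euclidean_space \<Rightarrow> real"
  assumes "\<phi> \<in> test_functions"
  obtains M R where "0 \<le> M" "0 < R" "\<And>p. \<bar>\<phi> p\<bar> \<le> M * indicator (cball 0 R) p"
proof -
  let ?K = "closure {p. \<phi> p \<noteq> 0}"
  obtain R where R: "0 < R" "\<And>p. p \<in> ?K \<Longrightarrow> norm p \<le> R"
    using compact_imp_bounded[OF test_functionD(2)[OF assms]] unfolding bounded_pos by blast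
  have "compact (\<phi> ` ?K)"
    by (intro compact_continuous_image smooth_continuous test_functionD assms)
  then obtain M where M: "0 < M" "\<And>p. p \<in> ?K \<Longrightarrow> norm (\<phi> p) \<le> M"
    using compact_imp_bounded[of "\<phi> ` ?K"] unfolding bounded_pos by blast
  have "\<bar>\<phi> p\<bar> \<le> M * indicator (cball 0 R) p" for p
    using M R not_closure_zero[of p \<phi>] by (cases "p \<in> ?K") (auto simp: indicator_def)
  then show ?thesis using M(1) R(1) that[of M R] by simp
qed

lemma test_borel: "\<phi> \<in> test_functions \<Longrightarrow> \<phi> \<in> borel_measurable borel"
  by (intro borel_measurable_continuous_onI smooth_continuous test_functionD)

section \<open>Integration against test functions\<close>

lemma locally_integrable_mult_test:
  fixes f \<phi> :: "'a::euclidean_space \<Rightarrow> real"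
  assumes "locally_integrable f" "f \<in> borel_measurable borel" "\<phi> \<in> test_functions"
  shows "integrable lborel (\<lambda>p. f p * \<phi> p)"
proof -
  obtain M R where MR: "0 \<le> M" "0 < R" "\<And>p. \<bar>\<phi> p\<bar> \<le> M * indicator (cball 0 R) p"
    using test_bounded[OF assms(3)] by metis
  have "set_integrable lborel (cball 0 R) f"
    using assms(1) by (auto simp: locally_integrable_def)
  then have "integrable lborel (\<lambda>p. M * (indicator (cball 0 R) p * f p))"
    by (auto simp: set_integrable_def)
  then show ?thesis
  proof (rule Bochner_Integration.integrable_bound)
    show "(\<lambda>p. f p * \<phi> p) \<in> borel_measurable lborel"
      using assms(2) test_borel[OF assms(3)] by simp
    show "AE p in lborel. norm (f p * \<phi> p) \<le> norm (M * (indicator (cball 0 R) p * f p))"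
    proof (rule AE_I2)
      fix p
      show "norm (f p * \<phi> p) \<le> norm (M * (indicator (cball 0 R) p * f p))"
        using mult_right_mono[OF MR(3)[of p] abs_ge_zero[of "f p"]] MR(1) by (simp add: abs_mult mult_ac)
    qed
  qed
qed

lemma continuous_locally_integrable:
  fixes f :: "'a::euclidean_space \<Rightarrow> real"
  assumes "continuous_on UNIV f"
  shows "locally_integrable f" "f \<in> borel_measurable borel"
proof -
  show "locally_integrable f"
    unfolding locally_integrable_def set_integrable_def
    using borel_integrable_compact continuous_on_subset[OF assms] by blast
qed (rule borel_measurable_continuous_onI[OF assms])

lemma test_integrable: "\<phi> \<in> test_functions \<Longrightarrow> integrable lborel \<phi>"
  using locally_integrable_mult_test[OF continuous_locally_integrable, of "\<lambda>_. 1" \<phi>]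
  by simp

text \<open>The difference quotients have integral zero by translation invariance.\<close>

lemma integral_directional_eq_0:
  fixes \<phi> :: "'a::euclidean_space \<Rightarrow> real"
  assumes "\<phi> \<in> test_functions"
  shows "(\<integral>p. frechet_derivative \<phi> (at p) v \<partial>lborel) = 0"
proof -
  let ?D = "\<lambda>p. frechet_derivative \<phi> (at p) v"
  define Q where "Q k p = real (Suc k) * (\<phi> (p + (1 / real (Suc k)) *\<^sub>R v) - \<phi> p)" for k p
  obtain M R where MR: "0 \<le> M" "0 < R" "\<And>p. \<bar>?D p\<bar> \<le> M * indicator (cball 0 R) p"
    using test_bounded[OF test_directional[OF assms]] by metis
  have D: "(\<phi> has_derivative frechet_derivative \<phi> (at p)) (at p)" for p
    using smooth_has_derivative test_functionD(1)[OF assms] .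
  have line: "((\<lambda>s. \<phi> (p + s *\<^sub>R v)) has_real_derivative ?D (p + s *\<^sub>R v)) (at s)" for p s
  proof -
    have "((\<lambda>s. \<phi> (p + s *\<^sub>R v)) has_derivative
        (\<lambda>h. frechet_derivative \<phi> (at (p + s *\<^sub>R v)) (h *\<^sub>R v))) (at s)"
      by (rule has_derivative_compose[OF _ D]) (auto intro!: derivative_eq_intros)
    moreover have "(\<lambda>h. frechet_derivative \<phi> (at (p + s *\<^sub>R v)) (h *\<^sub>R v)) = (*) (?D (p + s *\<^sub>R v))"
      using linear_scale[OF has_derivative_linear[OF D]] by (auto simp: mult.commute)
    ultimately show ?thesis by (simp add: has_field_derivative_def)
  qed
  have lim: "(\<lambda>k. Q k p) \<longlonglongrightarrow> ?D p" for p
  proof -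
    have "((\<lambda>h. (\<phi> (p + (0 + h) *\<^sub>R v) - \<phi> (p + 0 *\<^sub>R v)) / h) \<longlongrightarrow> ?D (p + 0 *\<^sub>R v)) (at 0)"
      using line[of p 0] unfolding DERIV_def .
    moreover have "filterlim (\<lambda>k. 1 / real (Suc k)) (at 0) sequentially"
      by (rule filterlim_atI) (use LIMSEQ_inverse_real_of_nat in \<open>auto simp: inverse_eq_divide\<close>)
    ultimately show ?thesis
      unfolding Q_def using filterlim_compose[where f = "\<lambda>k. 1 / real (Suc k)"]
      by (fastforce simp: mult.commute)
  qed
  have int: "integrable lborel \<phi>" by (rule test_integrable[OF assms])
  have shift: "integrable lborel (\<lambda>p. \<phi> (p + c))" "(\<integral>p. \<phi> (p + c) \<partial>lborel) = (\<integral>p. \<phi> p \<partial>lborel)" for c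
  proof -
    show "integrable lborel (\<lambda>p. \<phi> (p + c))"
      using int integrable_distr_eq[of "(+) c" lborel borel \<phi>] test_borel[OF assms]
      by (simp add: lborel_distr_plus add.commute)
    show "(\<integral>p. \<phi> (p + c) \<partial>lborel) = (\<integral>p. \<phi> p \<partial>lborel)"
      using integral_distr[of "(+) c" lborel borel \<phi>] test_borel[OF assms]
      by (simp add: lborel_distr_plus add.commute)
  qed
  have Q0: "(\<integral>p. Q k p \<partial>lborel) = 0" for k
    using int shift by (simp add: Q_def)
  \<comment> \<open>By the mean value theorem the quotient is a value of the derivative at distance
    at most \<open>norm v\<close> from \<open>p\<close>, because the increment is at most 1. Hence
    one enlarged ball serves all \<open>k\<close>.\<close>
  have bound: "\<bar>Q k p\<bar> \<le> M * indicator (cball 0 (R + norm v)) p" for k p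
  proof -
    have pos: "1 / real (Suc k) > 0" by simp
    obtain z where z: "0 < z" "z < 1 / real (Suc k)"
      "\<phi> (p + (1 / real (Suc k)) *\<^sub>R v) - \<phi> (p + 0 *\<^sub>R v) = (1 / real (Suc k) - 0) * ?D (p + z *\<^sub>R v)"
      using MVT2[OF pos line[of p]] by blast
    have "Q k p = ?D (p + z *\<^sub>R v)"
      using z(3) by (simp add: Q_def)
    moreover have "indicator (cball 0 R) (p + z *\<^sub>R v) \<le> (indicator (cball 0 (R + norm v)) p :: real)"
    proof -
      have "1 / real (Suc k) \<le> 1" by simp
      then have "z \<le> 1" using z(2) by linarith
      then have "norm (z *\<^sub>R v) \<le> norm v" using z(1) by (simp add: mult_left_le_one_le)
      then have "norm p \<le> norm (p + z *\<^sub>R v) + norm v"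
        using norm_triangle_ineq4[of "p + z *\<^sub>R v" "z *\<^sub>R v"] by simp
      then show ?thesis by (auto simp: indicator_def)
    qed
    ultimately show ?thesis
      using MR(3)[of "p + z *\<^sub>R v"] mult_left_mono[OF _ MR(1)] order_trans by metis
  qed
  have "(\<lambda>k. \<integral>p. Q k p \<partial>lborel) \<longlonglongrightarrow> (\<integral>p. ?D p \<partial>lborel)"
  proof (rule integral_dominated_convergence)
    show "integrable lborel (\<lambda>p. M * indicator (cball 0 (R + norm v)) p)"
      using emeasure_bounded_finite[of "cball 0 (R + norm v)"]
      by (intro integrable_mult_right integrable_real_indicator) auto
    show "?D \<in> borel_measurable lborel"
      using test_borel[OF test_directional[OF assms]] by simp
    show "Q k \<in> borel_measurable lborel" for k
    proof -
      have "(\<lambda>p. Q k p) \<in> borel_measurable borel"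
        unfolding Q_def using test_borel[OF assms] by measurable
      then show ?thesis by simp
    qed
  qed (use lim bound in auto)
  then show ?thesis by (simp add: Q0 LIMSEQ_const_iff)
qed

section \<open>Divergence-free vector fields\<close>

definition lie :: "('a::euclidean_space \<Rightarrow> 'a) \<Rightarrow> ('a \<Rightarrow> real) \<Rightarrow> 'a \<Rightarrow> real" where
  "lie V f p = frechet_derivative f (at p) (V p)"

text \<open>Smooth components make \<open>lie V\<close> preserve smooth functions and test
  functions; zero divergence makes \<open>- lie V\<close> the formal adjoint of
  \<open>lie V\<close>.\<close>

definition divfree_field :: "('a::euclidean_space \<Rightarrow> 'a) \<Rightarrow> bool" where
  "divfree_field V \<longleftrightarrow> (\<forall>b\<in>Basis. smooth (\<lambda>p. V p \<bullet> b)) \<and>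
     (\<forall>p. (\<Sum>b\<in>Basis. frechet_derivative (\<lambda>p. V p \<bullet> b) (at p) b) = 0)"

lemma lie_eqI: "(f has_derivative f') (at p) \<Longrightarrow> lie V f p = f' (V p)"
  using frechet_derivative_at unfolding lie_def by metis

lemma lie_eq_sum:
  assumes "smooth f"
  shows "lie V f p = (\<Sum>b\<in>Basis. (V p \<bullet> b) * frechet_derivative f (at p) b)"
proof -
  have lin: "linear (frechet_derivative f (at p))"
    using smooth_has_derivative[OF assms] by (rule has_derivative_linear)
  have "lie V f p = frechet_derivative f (at p) (\<Sum>b\<in>Basis. (V p \<bullet> b) *\<^sub>R b)"
    by (simp add: lie_def euclidean_representation)
  also have "\<dots> = (\<Sum>b\<in>Basis. (V p \<bullet> b) * frechet_derivative f (at p) b)"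
    by (simp add: linear_sum[OF lin] linear_scale[OF lin])
  finally show ?thesis .
qed

lemma lie_const [simp]: "lie V (\<lambda>p. c) p = 0"
  by (rule lie_eqI) (rule has_derivative_const)

lemma lie_add: "smooth f \<Longrightarrow> smooth g \<Longrightarrow> lie V (\<lambda>p. f p + g p) p = lie V f p + lie V g p"
  unfolding lie_def by (rule frechet_derivative_add)

lemma lie_mult:
  "smooth f \<Longrightarrow> smooth g \<Longrightarrow> lie V (\<lambda>p. f p * g p) p = f p * lie V g p + lie V f p * g p"
  unfolding lie_def by (rule frechet_derivative_mult)

lemma lie_add_fun: "smooth f \<Longrightarrow> smooth g \<Longrightarrow> lie V (\<lambda>p. f p + g p) = (\<lambda>p. lie V f p + lie V g p)"
  and lie_mult_fun:
    "smooth f \<Longrightarrow> smooth g \<Longrightarrow> lie V (\<lambda>p. f p * g p) = (\<lambda>p. f p * lie V g p + lie V f p * g p)"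
  by (intro ext, simp add: lie_add, intro ext, simp add: lie_mult)

lemma lie_powr:
  "smooth f \<Longrightarrow> f p > 0 \<Longrightarrow> lie V (\<lambda>p. f p powr c) p = c * f p powr (c - 1) * lie V f p"
  by (subst lie_eqI[OF has_derivative_powr_const[OF smooth_has_derivative]]) (auto simp: lie_def)

lemma lie_sum:
  "finite I \<Longrightarrow> (\<And>i. i \<in> I \<Longrightarrow> smooth (f i)) \<Longrightarrow>
    lie V (\<lambda>p. \<Sum>i\<in>I. f i p) p = (\<Sum>i\<in>I. lie V (f i) p)"
  by (induction I rule: finite_induct) (simp_all add: lie_add smooth_sum)

lemma smooth_lie:
  assumes "divfree_field V" "smooth f"
  shows "smooth (lie V f)"
proof -
  have "smooth (\<lambda>p. \<Sum>b\<in>Basis. (V p \<bullet> b) * frechet_derivative f (at p) b)"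
    using assms by (intro smooth_sum smooth_mult smooth_directional) (auto simp: divfree_field_def)
  then show ?thesis
    unfolding lie_eq_sum[OF assms(2), symmetric] .
qed

lemma test_lie:
  assumes "divfree_field V" "\<phi> \<in> test_functions"
  shows "lie V \<phi> \<in> test_functions"
proof -
  have "(\<lambda>p. \<Sum>b\<in>Basis. (V p \<bullet> b) * frechet_derivative \<phi> (at p) b) \<in> test_functions"
    using assms by (intro test_sum test_mult test_directional) (auto simp: divfree_field_def)
  then show ?thesis
    unfolding lie_eq_sum[OF test_functionD(1)[OF assms(2)], symmetric] .
qed

text \<open>In div(\<phi> V) = V \<phi> + \<phi> div V the last term is zero. This is the expression
  that \<open>dist_field\<close> produces, since there the test function is multiplied by the
  component of \<open>V\<close> before it is differentiated.\<close>

lemma divergence_mult: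
  assumes "divfree_field V" "smooth \<phi>"
  shows "(\<Sum>b\<in>Basis. frechet_derivative (\<lambda>p. (V p \<bullet> b) * \<phi> p) (at p) b) = lie V \<phi> p"
proof -
  have "(\<Sum>b\<in>Basis. frechet_derivative (\<lambda>p. (V p \<bullet> b) * \<phi> p) (at p) b) =
      (\<Sum>b\<in>Basis. (V p \<bullet> b) * frechet_derivative \<phi> (at p) b
        + frechet_derivative (\<lambda>p. V p \<bullet> b) (at p) b * \<phi> p)"
    using assms by (intro sum.cong frechet_derivative_mult) (auto simp: divfree_field_def)
  also have "\<dots> = lie V \<phi> p"
    using assms(1) by (simp add: lie_eq_sum[OF assms(2)] sum.distrib divfree_field_def
        flip: sum_distrib_right)
  finally show ?thesis .
qed

lemma test_field_component:
  assumes "divfree_field V" "\<phi> \<in> test_functions" "b \<in> Basis"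
  shows "(\<lambda>p. (V p \<bullet> b) * \<phi> p) \<in> test_functions"
  using assms by (intro test_mult) (auto simp: divfree_field_def)

lemma integral_lie_eq_0:
  assumes "divfree_field V" "\<phi> \<in> test_functions"
  shows "(\<integral>p. lie V \<phi> p \<partial>lborel) = 0"
proof -
  have "(\<integral>p. lie V \<phi> p \<partial>lborel) =
      (\<integral>p. (\<Sum>b\<in>Basis. frechet_derivative (\<lambda>p. (V p \<bullet> b) * \<phi> p) (at p) b) \<partial>lborel)"
    using divergence_mult[OF assms(1) test_functionD(1)[OF assms(2)]] by simp
  also have "\<dots> = (\<Sum>b\<in>Basis. \<integral>p. frechet_derivative (\<lambda>p. (V p \<bullet> b) * \<phi> p) (at p) b \<partial>lborel)"
    by (intro Bochner_Integration.integral_sum test_integrable test_directional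
        test_field_component assms)
  also have "\<dots> = 0"
    by (intro sum.neutral ballI integral_directional_eq_0 test_field_component assms)
  finally show ?thesis .
qed

text \<open>Integrates the product rule for \<open>f p * \<phi> p\<close>, which is a test function
  even when the support of \<open>f\<close> is not compact.\<close>

lemma integral_lie_by_parts:
  assumes "divfree_field V" "smooth f" "\<phi> \<in> test_functions"
  shows "(\<integral>p. f p * lie V \<phi> p \<partial>lborel) = - (\<integral>p. lie V f p * \<phi> p \<partial>lborel)"
proof -
  have "0 = (\<integral>p. lie V (\<lambda>p. f p * \<phi> p) p \<partial>lborel)"
    using assms by (intro integral_lie_eq_0[symmetric] test_mult)
  also have "\<dots> = (\<integral>p. f p * lie V \<phi> p + lie V f p * \<phi> p \<partial>lborel)"
    by (simp add: lie_mult assms(2) test_functionD(1)[OF assms(3)])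
  also have "\<dots> = (\<integral>p. f p * lie V \<phi> p \<partial>lborel) + (\<integral>p. lie V f p * \<phi> p \<partial>lborel)"
    using assms by (intro Bochner_Integration.integral_add test_integrable test_mult test_lie smooth_lie)
  finally show ?thesis by simp
qed

lemma integral_lie_lie_by_parts:
  assumes "divfree_field V" "smooth f" "\<phi> \<in> test_functions"
  shows "(\<integral>p. f p * lie V (lie V \<phi>) p \<partial>lborel) = (\<integral>p. lie V (lie V f) p * \<phi> p \<partial>lborel)"
  using assms by (simp add: integral_lie_by_parts test_lie smooth_lie)

text \<open>All derivatives fall on the test function, so local integrability of \<open>f\<close>
  suffices. The sum over the basis passes under the integral because each summand is integrable by
  itself.\<close>

lemma dist_field_dist_of:
  fixes f \<phi> :: "'a::euclidean_space \<Rightarrow> real"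
  assumes "divfree_field V" "locally_integrable f" "f \<in> borel_measurable borel" "\<phi> \<in> test_functions"
  shows "dist_field V (dist_of f) \<phi> = - (\<integral>p. f p * lie V \<phi> p \<partial>lborel)"
proof -
  have "dist_field V (dist_of f) \<phi> =
      - (\<Sum>b\<in>Basis. \<integral>p. f p * frechet_derivative (\<lambda>p. (V p \<bullet> b) * \<phi> p) (at p) b \<partial>lborel)"
    by (simp add: dist_field_def dist_mult_def dist_partial_def dist_of_def sum_negf)
  also have "(\<Sum>b\<in>Basis. \<integral>p. f p * frechet_derivative (\<lambda>p. (V p \<bullet> b) * \<phi> p) (at p) b \<partial>lborel) =
      (\<integral>p. (\<Sum>b\<in>Basis. f p * frechet_derivative (\<lambda>p. (V p \<bullet> b) * \<phi> p) (at p) b) \<partial>lborel)"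
    by (intro Bochner_Integration.integral_sum[symmetric] locally_integrable_mult_test
        test_directional test_field_component assms)
  also have "\<dots> = (\<integral>p. f p * lie V \<phi> p \<partial>lborel)"
    using divergence_mult[OF assms(1) test_functionD(1)[OF assms(4)]]
    by (simp flip: sum_distrib_left)
  finally show ?thesis .
qed

text \<open>A functional carries no linearity by its type, and the inner application is not of the
  form \<open>dist_of g\<close>. The outer field is therefore unfolded into the test functions
  \<open>?\<psi> b\<close>, and linearity is taken from the integral.\<close>

lemma dist_field_dist_field_dist_of:
  fixes f \<phi> :: "'a::euclidean_space \<Rightarrow> real"
  assumes V: "divfree_field V" and f: "locally_integrable f" "f \<in> borel_measurable borel"
    and \<phi>: "\<phi> \<in> test_functions"
  shows "dist_field V (dist_field V (dist_of f)) \<phi> = (\<integral>p. f p * lie V (lie V \<phi>) p \<partial>lborel)"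
proof -
  let ?\<psi> = "\<lambda>b p. frechet_derivative (\<lambda>p. (V p \<bullet> b) * \<phi> p) (at p) b"
  have \<psi>: "?\<psi> b \<in> test_functions" if "b \<in> Basis" for b
    by (intro test_directional test_field_component V \<phi> that)
  have "dist_field V (dist_field V (dist_of f)) \<phi> =
      (\<Sum>b\<in>Basis. - dist_field V (dist_of f) (?\<psi> b))"
    unfolding dist_field_def[of V "dist_field V (dist_of f)"] dist_mult_def dist_partial_def ..
  also have "\<dots> = (\<Sum>b\<in>Basis. \<integral>p. f p * lie V (?\<psi> b) p \<partial>lborel)"
    using dist_field_dist_of[OF V f \<psi>] by (intro sum.cong) auto
  also have "\<dots> = (\<integral>p. (\<Sum>b\<in>Basis. f p * lie V (?\<psi> b) p) \<partial>lborel)"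
    by (intro Bochner_Integration.integral_sum[symmetric] locally_integrable_mult_test
        test_lie \<psi> V f)
  also have "\<dots> = (\<integral>p. f p * lie V (\<lambda>p. \<Sum>b\<in>Basis. ?\<psi> b p) p \<partial>lborel)"
    using \<psi>[THEN test_functionD(1)] by (simp add: lie_sum sum_distrib_left)
  also have "(\<lambda>p. \<Sum>b\<in>Basis. ?\<psi> b p) = lie V \<phi>"
    using divergence_mult[OF V test_functionD(1)[OF \<phi>]] by auto
  finally show ?thesis .
qed

section \<open>Second-order calculus of a family of vector fields\<close>

definition sum_squares :: "'i set \<Rightarrow> ('i \<Rightarrow> 'a::euclidean_space \<Rightarrow> 'a) \<Rightarrow> ('a \<Rightarrow> real) \<Rightarrow> 'a \<Rightarrow> real"
  where "sum_squares J X f p = (\<Sum>j\<in>J. lie (X j) (lie (X j) f) p)"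

text \<open>The carre du champ, a bilinear form that measures how far \<open>sum_squares\<close> is
  from satisfying the product rule of a derivation.\<close>

definition carre :: "'i set \<Rightarrow> ('i \<Rightarrow> 'a::euclidean_space \<Rightarrow> 'a) \<Rightarrow> ('a \<Rightarrow> real) \<Rightarrow> ('a \<Rightarrow> real) \<Rightarrow> 'a \<Rightarrow> real"
  where "carre J X f g p = (\<Sum>j\<in>J. lie (X j) f p * lie (X j) g p)"

lemma carre_commute: "carre J X f g p = carre J X g f p"
  by (simp add: carre_def mult.commute)

lemma carre_add:
  "smooth f \<Longrightarrow> smooth g \<Longrightarrow> carre J X (\<lambda>p. f p + g p) h p = carre J X f h p + carre J X g h p"
  by (simp add: carre_def lie_add algebra_simps sum.distrib)

lemma carre_mult:
  "smooth f \<Longrightarrow> smooth g \<Longrightarrow>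
    carre J X (\<lambda>p. f p * g p) h p = f p * carre J X g h p + g p * carre J X f h p"
  by (simp add: carre_def lie_mult algebra_simps sum.distrib sum_distrib_left)

lemma carre_powr:
  "smooth f \<Longrightarrow> f p > 0 \<Longrightarrow>
    carre J X (\<lambda>p. f p powr c) h p = c * f p powr (c - 1) * carre J X f h p"
  by (simp add: carre_def lie_powr algebra_simps sum_distrib_left)

context
  fixes J :: "'i set" and X :: "'i \<Rightarrow> 'a::euclidean_space \<Rightarrow> 'a"
  assumes X: "\<And>j. j \<in> J \<Longrightarrow> divfree_field (X j)"
begin

lemma test_sum_squares: "finite J \<Longrightarrow> \<phi> \<in> test_functions \<Longrightarrow> sum_squares J X \<phi> \<in> test_functions"
  unfolding sum_squares_def[abs_def] by (intro test_sum test_lie X)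

lemma sum_squares_add:
  assumes "smooth f" "smooth g"
  shows "sum_squares J X (\<lambda>p. f p + g p) p = sum_squares J X f p + sum_squares J X g p"
  using assms by (simp add: sum_squares_def lie_add_fun smooth_lie X sum.distrib lie_add)

lemma sum_squares_mult:
  assumes "smooth f" "smooth g"
  shows "sum_squares J X (\<lambda>p. f p * g p) p =
    f p * sum_squares J X g p + g p * sum_squares J X f p + 2 * carre J X f g p"
proof -
  have "lie (X j) (lie (X j) (\<lambda>p. f p * g p)) p =
      f p * lie (X j) (lie (X j) g) p + g p * lie (X j) (lie (X j) f) p
        + 2 * (lie (X j) f p * lie (X j) g p)" if "j \<in> J" for j
    using assms X[OF that]
    by (simp add: lie_mult_fun lie_add lie_mult smooth_lie smooth_mult algebra_simps)
  then show ?thesis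
    by (simp add: sum_squares_def carre_def sum.distrib sum_distrib_left)
qed

text \<open>Positivity is required everywhere, unlike in \<open>carre_powr\<close>, because the
  first derivative is differentiated again as a function.\<close>

lemma sum_squares_powr:
  assumes "smooth f" "\<And>p. f p > 0"
  shows "sum_squares J X (\<lambda>p. f p powr c) p =
    c * f p powr (c - 1) * sum_squares J X f p + c * (c - 1) * f p powr (c - 2) * carre J X f f p"
proof -
  have "lie (X j) (lie (X j) (\<lambda>p. f p powr c)) p =
      c * f p powr (c - 1) * lie (X j) (lie (X j) f) p
        + c * (c - 1) * f p powr (c - 2) * (lie (X j) f p * lie (X j) f p)" if "j \<in> J" for j
  proof -
    have "lie (X j) (\<lambda>p. f p powr c) = (\<lambda>p. (c * f p powr (c - 1)) * lie (X j) f p)"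
      using assms by (intro ext) (simp add: lie_powr)
    moreover have "smooth (\<lambda>p. f p powr (c - 1))" "smooth (lie (X j) f)"
      using assms X[OF that] by (auto intro: smooth_powr smooth_lie)
    ultimately show ?thesis
      using assms
      by (simp add: lie_mult lie_powr smooth_mult smooth_const algebra_simps)
  qed
  then show ?thesis
    by (simp add: sum_squares_def carre_def sum.distrib sum_distrib_left)
qed

lemma integral_sum_squares_by_parts:
  assumes "finite J" "smooth f" "\<phi> \<in> test_functions"
  shows "(\<integral>p. f p * sum_squares J X \<phi> p \<partial>lborel) = (\<integral>p. sum_squares J X f p * \<phi> p \<partial>lborel)"
proof -
  have "(\<integral>p. f p * sum_squares J X \<phi> p \<partial>lborel) =
      (\<Sum>j\<in>J. \<integral>p. f p * lie (X j) (lie (X j) \<phi>) p \<partial>lborel)"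
    unfolding sum_squares_def sum_distrib_left
    by (intro Bochner_Integration.integral_sum test_integrable test_mult test_lie X assms)
  also have "\<dots> = (\<Sum>j\<in>J. \<integral>p. lie (X j) (lie (X j) f) p * \<phi> p \<partial>lborel)"
    using assms X by (intro sum.cong integral_lie_lie_by_parts) auto
  also have "\<dots> = (\<integral>p. sum_squares J X f p * \<phi> p \<partial>lborel)"
    unfolding sum_squares_def sum_distrib_right
    by (intro Bochner_Integration.integral_sum[symmetric] test_integrable test_mult smooth_lie X assms)
  finally show ?thesis .
qed

text \<open>Here \<open>f\<close> is never differentiated, so the singular candidate is
  covered.\<close>

lemma dist_sum_squares:
  fixes f \<phi> :: "'a \<Rightarrow> real"
  assumes "finite J" "locally_integrable f" "f \<in> borel_measurable borel" "\<phi> \<in> test_functions"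
  shows "(\<Sum>j\<in>J. dist_field (X j) (dist_field (X j) (dist_of f)) \<phi>) =
    (\<integral>p. f p * sum_squares J X \<phi> p \<partial>lborel)"
proof -
  have "(\<Sum>j\<in>J. dist_field (X j) (dist_field (X j) (dist_of f)) \<phi>) =
      (\<Sum>j\<in>J. \<integral>p. f p * lie (X j) (lie (X j) \<phi>) p \<partial>lborel)"
    using assms X by (intro sum.cong dist_field_dist_field_dist_of) auto
  also have "\<dots> = (\<integral>p. f p * sum_squares J X \<phi> p \<partial>lborel)"
    unfolding sum_squares_def sum_distrib_left
    by (intro Bochner_Integration.integral_sum[symmetric] locally_integrable_mult_test test_lie X assms)
  finally show ?thesis .
qed

end

section \<open>The vector fields of the anisotropic Heisenberg group\<close>

text \<open>The \<open>t\<close>-component of every field is sign times weight times partner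
  coordinate; with \<open>heis_partner\<close> and \<open>heis_sign\<close> this replaces the case
  distinction in \<open>heis_X\<close>. The weight is the structure constant of the coordinate
  pair.\<close>

definition heis_weight :: "nat \<Rightarrow> nat \<Rightarrow> real" where
  "heis_weight n j = (if j = 1 \<or> j = n + 1 then 1 / 2 else 1)"

definition heis_partner :: "nat \<Rightarrow> nat \<Rightarrow> nat" where
  "heis_partner n j = (if j \<le> n then j + n else j - n)"

definition heis_sign :: "nat \<Rightarrow> nat \<Rightarrow> real" where
  "heis_sign n j = (if j \<le> n then - 1 else 1)"

text \<open>The factor 1/2 makes the derivative along field \<open>j\<close> equal to
  \<open>w j\<close> times the coordinate. The forms A, B, A - B and the carre du champ of
  \<open>t\<close> all have this shape.\<close>

definition coord_quad ::
  "nat \<Rightarrow> (nat \<Rightarrow> 'm::finite) \<Rightarrow> (nat \<Rightarrow> real) \<Rightarrow> (real ^ 'm) \<times> real \<Rightarrow> real" where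
  "coord_quad n e w p = (\<Sum>j = 1..2 * n. w j / 2 * (fst p $ e j)\<^sup>2)"

lemma snd_heis_X:
  assumes "n \<ge> 1" "j \<in> {1..2 * n}"
  shows "snd (heis_X n e j p) = heis_sign n j * heis_weight n j * fst p $ e (heis_partner n j)"
  using assms by (auto simp: heis_X_def heis_sign_def heis_weight_def heis_partner_def)

lemma fst_heis_X: "fst (heis_X n e j p) = axis (e j) 1"
  by (simp add: heis_X_def)

lemma bounded_linear_coord: "bounded_linear (\<lambda>p :: (real ^ 'm) \<times> real. fst p $ i)"
  by (rule bounded_linear_compose[OF bounded_linear_vec_nth bounded_linear_fst])

lemma sum_split_weights:
  fixes f :: "nat \<Rightarrow> real"
  assumes "n \<ge> 1"
  shows "(\<Sum>j = 1..2 * n. f j) = f 1 + f (n + 1) + (\<Sum>j\<in>{2..2 * n} - {n + 1}. f j)"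
proof -
  have "{1..2 * n} = insert 1 (insert (n + 1) ({2..2 * n} - {n + 1}))"
    using assms by auto
  moreover have "finite ({2..2 * n} - {n + 1})" "1 \<notin> insert (n + 1) ({2..2 * n} - {n + 1})"
    "n + 1 \<notin> {2..2 * n} - {n + 1}"
    using assms by auto
  ultimately show ?thesis by (simp only: sum.insert finite_insert add.assoc not_False_eq_True)
qed

lemma heis_B_eq: "n \<ge> 1 \<Longrightarrow> heis_B n e (fst p) = coord_quad n e (heis_weight n) p"
  unfolding coord_quad_def heis_B_def
  by (subst sum_split_weights) (auto simp: heis_weight_def sum_distrib_left)

lemma heis_A_eq: "n \<ge> 1 \<Longrightarrow> heis_A n e (fst p) = coord_quad n e (\<lambda>j. 1) p"
  unfolding coord_quad_def heis_A_def
  by (subst sum_split_weights) (auto simp: sum_distrib_left)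

lemma coord_quad_add:
  "coord_quad n e v p + coord_quad n e w p = coord_quad n e (\<lambda>j. v j + w j) p"
  by (simp add: coord_quad_def sum.distrib[symmetric] algebra_simps add_divide_distrib)

lemma coord_quad_nonneg: "(\<And>j. 0 \<le> w j) \<Longrightarrow> 0 \<le> coord_quad n e w p"
  unfolding coord_quad_def by (intro sum_nonneg mult_nonneg_nonneg) auto

lemma smooth_coord_quad: "smooth (coord_quad n e w)"
  unfolding coord_quad_def[abs_def]
  by (intro smooth_sum smooth_mult smooth_const smooth_power smooth_linear bounded_linear_coord)

section \<open>First and second derivatives of \<open>t\<close> and of diagonal quadratic
  forms\<close>

context
  fixes n :: nat and e :: "nat \<Rightarrow> 'm::finite"
  assumes n: "1 \<le> n" and e: "bij_betw e {1..2 * n} UNIV"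
begin

lemma axis_coord:
  assumes "i \<in> {1..2 * n}" "j \<in> {1..2 * n}"
  shows "axis (e j) (1::real) $ e i = (if i = j then 1 else 0)"
  using inj_on_eq_iff[OF bij_betw_imp_inj_on[OF e] assms] by (auto simp: axis_def)

lemma partner_in: "j \<in> {1..2 * n} \<Longrightarrow> heis_partner n j \<in> {1..2 * n}"
  and partner_partner: "j \<in> {1..2 * n} \<Longrightarrow> heis_partner n (heis_partner n j) = j"
  and sign_partner: "j \<in> {1..2 * n} \<Longrightarrow> heis_sign n (heis_partner n j) = - heis_sign n j"
  and weight_partner: "j \<in> {1..2 * n} \<Longrightarrow> heis_weight n (heis_partner n j) = heis_weight n j"
  using n by (auto simp: heis_partner_def heis_sign_def heis_weight_def)

text \<open>The derivative of a component in its own direction is a product with factors taken from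
  \<open>snd b\<close> and \<open>fst b\<close>, and for a basis vector one of these is
  zero.\<close>

lemma divfree_heis_X:
  assumes j: "j \<in> {1..2 * n}"
  shows "divfree_field (heis_X n e j)"
proof -
  define c where "c = heis_sign n j * heis_weight n j"
  have X: "heis_X n e j p \<bullet> b = axis (e j) 1 \<bullet> fst b + (c * snd b) * fst p $ e (heis_partner n j)"
    for p and b :: "(real ^ 'm) \<times> real"
    using snd_heis_X[OF n j, of e p]
    by (simp add: inner_prod_def fst_heis_X c_def)
  have D: "((\<lambda>p. heis_X n e j p \<bullet> b) has_derivative
      (\<lambda>v. (c * snd b) * fst v $ e (heis_partner n j))) (at p)" for p b
    unfolding X
    by (auto intro!: derivative_eq_intros bounded_linear_imp_has_derivative[OF bounded_linear_coord])
  have "frechet_derivative (\<lambda>p. heis_X n e j p \<bullet> b) (at p) b = 0" if "b \<in> Basis" for p b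
    using that unfolding frechet_derivative_at[OF D, symmetric] by (auto simp: Basis_prod_def)
  moreover have "smooth (\<lambda>p. heis_X n e j p \<bullet> b)" for b
    unfolding X by (intro smooth_add smooth_mult smooth_const smooth_linear bounded_linear_coord)
  ultimately show ?thesis by (simp add: divfree_field_def)
qed

lemma lie_coord:
  assumes "i \<in> {1..2 * n}" "j \<in> {1..2 * n}"
  shows "lie (heis_X n e j) (\<lambda>p. fst p $ e i) p = (if i = j then 1 else 0)"
  by (subst lie_eqI[OF bounded_linear_imp_has_derivative[OF bounded_linear_coord]])
    (simp only: fst_heis_X axis_coord[OF assms])

lemma lie_snd:
  assumes "j \<in> {1..2 * n}"
  shows "lie (heis_X n e j) snd p = heis_sign n j * heis_weight n j * fst p $ e (heis_partner n j)"
  by (subst lie_eqI[OF bounded_linear_imp_has_derivative[OF bounded_linear_snd]])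
    (rule snd_heis_X[OF n assms])

lemma lie_coord_quad:
  assumes j: "j \<in> {1..2 * n}"
  shows "lie (heis_X n e j) (coord_quad n e w) p = w j * fst p $ e j"
proof -
  have "lie (heis_X n e j) (coord_quad n e w) p =
      (\<Sum>i = 1..2 * n. lie (heis_X n e j) (\<lambda>p. w i / 2 * ((fst p $ e i) * (fst p $ e i))) p)"
    unfolding coord_quad_def[abs_def] power2_eq_square
    by (intro lie_sum smooth_mult smooth_const smooth_linear bounded_linear_coord) auto
  also have "\<dots> = (\<Sum>i = 1..2 * n. if j = i then w i * fst p $ e i else 0)"
  proof (rule sum.cong)
    fix i assume i: "i \<in> {1..2 * n}"
    have s: "smooth (\<lambda>p :: (real ^ 'm) \<times> real. fst p $ e i)"
      by (intro smooth_linear bounded_linear_coord)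
    show "lie (heis_X n e j) (\<lambda>p. w i / 2 * ((fst p $ e i) * (fst p $ e i))) p =
        (if j = i then w i * fst p $ e i else 0)"
      unfolding lie_mult[OF smooth_const smooth_mult[OF s s]] lie_mult[OF s s] lie_coord[OF i j]
      by auto
  qed simp
  also have "\<dots> = w j * fst p $ e j"
    using j by (subst sum.delta') auto
  finally show ?thesis .
qed

lemma heis_lap_coord_quad:
  "sum_squares {1..2 * n} (heis_X n e) (coord_quad n e w) p = (\<Sum>j = 1..2 * n. w j)"
  unfolding sum_squares_def
proof (rule sum.cong)
  fix j assume j: "j \<in> {1..2 * n}"
  have "lie (heis_X n e j) (coord_quad n e w) = (\<lambda>p. w j * fst p $ e j)"
    using lie_coord_quad[OF j] by auto
  then show "lie (heis_X n e j) (lie (heis_X n e j) (coord_quad n e w)) p = w j"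
    using lie_coord[OF j j] by (simp add: lie_mult smooth_const smooth_linear bounded_linear_coord)
qed simp

lemma heis_lap_snd: "sum_squares {1..2 * n} (heis_X n e) snd p = 0"
  unfolding sum_squares_def
proof (rule sum.neutral, rule ballI)
  fix j assume j: "j \<in> {1..2 * n}"
  have "lie (heis_X n e j) snd = (\<lambda>p. heis_sign n j * heis_weight n j * fst p $ e (heis_partner n j))"
    using lie_snd[OF j] by auto
  moreover have "heis_partner n j \<noteq> j"
    using j n by (auto simp: heis_partner_def)
  ultimately show "lie (heis_X n e j) (lie (heis_X n e j) snd) p = 0"
    using lie_coord[OF partner_in[OF j] j]
    by (simp add: lie_mult smooth_const smooth_linear bounded_linear_coord)
qed

lemma heis_carre_coord_quad:
  "carre {1..2 * n} (heis_X n e) (coord_quad n e v) (coord_quad n e w) p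
    = coord_quad n e (\<lambda>j. 2 * v j * w j) p"
  unfolding carre_def coord_quad_def[of _ _ "\<lambda>j. 2 * v j * w j"]
  by (intro sum.cong) (simp_all add: lie_coord_quad power2_eq_square)

text \<open>The partner map is an involution that preserves the weights, so reindexing by it turns
  partner coordinates into coordinates.\<close>

lemma heis_carre_snd_snd:
  "carre {1..2 * n} (heis_X n e) snd snd p = coord_quad n e (\<lambda>j. 2 * (heis_weight n j)\<^sup>2) p"
proof -
  have "carre {1..2 * n} (heis_X n e) snd snd p =
      (\<Sum>j = 1..2 * n. (heis_weight n j)\<^sup>2 * (fst p $ e (heis_partner n j))\<^sup>2)"
    unfolding carre_def
    by (intro sum.cong) (auto simp: lie_snd heis_sign_def power2_eq_square)
  also have "\<dots> = (\<Sum>j = 1..2 * n. (heis_weight n j)\<^sup>2 * (fst p $ e j)\<^sup>2)"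
    by (rule sum.reindex_bij_witness[where i = "heis_partner n" and j = "heis_partner n"])
      (use partner_in partner_partner weight_partner in auto)
  finally show ?thesis by (simp add: coord_quad_def)
qed

text \<open>The terms belonging to \<open>j\<close> and to its partner cancel.\<close>

lemma heis_carre_coord_quad_snd:
  assumes "\<And>j. j \<in> {1..2 * n} \<Longrightarrow> w (heis_partner n j) = w j"
  shows "carre {1..2 * n} (heis_X n e) (coord_quad n e w) snd p = 0"
proof -
  let ?f = "\<lambda>j. heis_sign n j * (w j * heis_weight n j * (fst p $ e j * fst p $ e (heis_partner n j)))"
  have "carre {1..2 * n} (heis_X n e) (coord_quad n e w) snd p = (\<Sum>j = 1..2 * n. ?f j)"
    unfolding carre_def by (intro sum.cong) (auto simp: lie_snd lie_coord_quad)
  moreover have "(\<Sum>j = 1..2 * n. ?f j) = (\<Sum>j = 1..2 * n. - ?f j)"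
    by (rule sum.reindex_bij_witness[where i = "heis_partner n" and j = "heis_partner n"])
      (use partner_in partner_partner weight_partner sign_partner assms in \<open>auto simp: mult_ac\<close>)
  ultimately show ?thesis by (simp add: sum_negf)
qed

end

section \<open>The regularised fundamental solution\<close>

text \<open>
  The functions \<open>reg_a\<close>, \<open>reg_b\<close>, \<open>reg_r\<close> are \<open>A - B\<close>, \<open>B + \<epsilon>\<close> and \<open>sqrt ((B + \<epsilon>)\<^sup>2 + t\<^sup>2)\<close>; for
  \<open>\<epsilon> = 0\<close> the function \<open>reg_G\<close> is the candidate itself, with junk value \<open>0\<close> at the origin.
\<close>

definition reg_a :: "nat \<Rightarrow> (nat \<Rightarrow> 'm::finite) \<Rightarrow> (real ^ 'm) \<times> real \<Rightarrow> real" where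
  "reg_a n e = coord_quad n e (\<lambda>j. 1 - heis_weight n j)"

definition reg_b :: "nat \<Rightarrow> (nat \<Rightarrow> 'm::finite) \<Rightarrow> real \<Rightarrow> (real ^ 'm) \<times> real \<Rightarrow> real" where
  "reg_b n e \<epsilon> p = \<epsilon> + coord_quad n e (heis_weight n) p"

definition reg_r :: "nat \<Rightarrow> (nat \<Rightarrow> 'm::finite) \<Rightarrow> real \<Rightarrow> (real ^ 'm) \<times> real \<Rightarrow> real" where
  "reg_r n e \<epsilon> p = (reg_b n e \<epsilon> p * reg_b n e \<epsilon> p + snd p * snd p) powr (1 / 2)"

text \<open>Roots and reciprocals are written with \<open>powr\<close>, here and in
  \<open>reg_r\<close>, so that one power rule for \<open>lie\<close>, \<open>carre\<close> and
  \<open>sum_squares\<close> covers them all.\<close>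

definition reg_h :: "nat \<Rightarrow> (nat \<Rightarrow> 'm::finite) \<Rightarrow> real \<Rightarrow> (real ^ 'm) \<times> real \<Rightarrow> real" where
  "reg_h n e \<epsilon> p = (reg_b n e \<epsilon> p + reg_r n e \<epsilon> p) powr (1 / 2) * reg_r n e \<epsilon> p powr (- 1)"

definition reg_G :: "nat \<Rightarrow> (nat \<Rightarrow> 'm::finite) \<Rightarrow> real \<Rightarrow> (real ^ 'm) \<times> real \<Rightarrow> real" where
  "reg_G n e \<epsilon> p = reg_h n e \<epsilon> p * (reg_a n e p + reg_r n e \<epsilon> p) powr (- (real n - 1 / 2))"

lemma heis_weight_nonneg: "0 \<le> heis_weight n j" "0 \<le> 1 - heis_weight n j"
  by (auto simp: heis_weight_def)

text \<open>These sums are the values of the sub-Laplacian on \<open>reg_a\<close> and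
  \<open>reg_b\<close>. In the first one only the two exceptional indices contribute, 1/2
  each.\<close>

lemma sum_heis_weight:
  assumes "1 \<le> n"
  shows "(\<Sum>j = 1..2 * n. 1 - heis_weight n j) = 1" "(\<Sum>j = 1..2 * n. heis_weight n j) = 2 * real n - 1"
proof -
  have "(\<Sum>j = 1..2 * n. 1 - heis_weight n j) = 1"
    using assms by (subst sum_split_weights) (auto simp: heis_weight_def)
  moreover have "(\<Sum>j = 1..2 * n. 1 - heis_weight n j) = 2 * real n - (\<Sum>j = 1..2 * n. heis_weight n j)"
    by (simp add: sum_subtractf)
  ultimately show "(\<Sum>j = 1..2 * n. 1 - heis_weight n j) = 1"
    "(\<Sum>j = 1..2 * n. heis_weight n j) = 2 * real n - 1" by linarith+
qed

lemma reg_a_nonneg: "0 \<le> reg_a n e p"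
  unfolding reg_a_def by (rule coord_quad_nonneg) (rule heis_weight_nonneg)

lemma reg_b_ge: "\<epsilon> \<le> reg_b n e \<epsilon> p"
  using coord_quad_nonneg[of "heis_weight n" n e p] heis_weight_nonneg by (simp add: reg_b_def)

lemma reg_r_eq: "reg_r n e \<epsilon> p = sqrt ((reg_b n e \<epsilon> p)\<^sup>2 + (snd p)\<^sup>2)"
  by (simp add: reg_r_def powr_half_sqrt power2_eq_square)

lemma reg_b_le_r: "reg_b n e \<epsilon> p \<le> reg_r n e \<epsilon> p"
  unfolding reg_r_eq by (rule real_le_rsqrt) simp

context
  fixes \<epsilon> :: real
  assumes \<epsilon>: "0 < \<epsilon>"
begin

lemma reg_pos:
  "0 < reg_b n e \<epsilon> p" "0 < reg_b n e \<epsilon> p * reg_b n e \<epsilon> p + snd p * snd p"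
  "0 < reg_r n e \<epsilon> p" "0 < reg_b n e \<epsilon> p + reg_r n e \<epsilon> p" "0 < reg_a n e p + reg_r n e \<epsilon> p"
proof -
  show b: "0 < reg_b n e \<epsilon> p" using reg_b_ge[of \<epsilon> n e p] \<epsilon> by simp
  then show "0 < reg_b n e \<epsilon> p * reg_b n e \<epsilon> p + snd p * snd p" by (intro add_pos_nonneg) auto
  show r: "0 < reg_r n e \<epsilon> p" using b reg_b_le_r[of n e \<epsilon> p] by simp
  show "0 < reg_b n e \<epsilon> p + reg_r n e \<epsilon> p" using b r by simp
  show "0 < reg_a n e p + reg_r n e \<epsilon> p" using r reg_a_nonneg[of n e p] by simp
qed

lemma smooth_reg:
  "smooth (reg_a n e)" "smooth (reg_b n e \<epsilon>)" "smooth (reg_r n e \<epsilon>)" "smooth (reg_h n e \<epsilon>)"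
  "smooth (reg_G n e \<epsilon>)"
proof -
  show a: "smooth (reg_a n e)" unfolding reg_a_def by (rule smooth_coord_quad)
  show b: "smooth (reg_b n e \<epsilon>)"
    unfolding reg_b_def[abs_def] by (intro smooth_add smooth_const smooth_coord_quad)
  show r: "smooth (reg_r n e \<epsilon>)"
    unfolding reg_r_def[abs_def]
    by (intro smooth_powr smooth_add smooth_mult b smooth_linear bounded_linear_snd reg_pos)
  show h: "smooth (reg_h n e \<epsilon>)"
    unfolding reg_h_def[abs_def] by (intro smooth_powr smooth_add smooth_mult b r reg_pos)
  show "smooth (reg_G n e \<epsilon>)"
    unfolding reg_G_def[abs_def] by (intro smooth_powr smooth_add smooth_mult a r h reg_pos)
qed

end

text \<open>The left side is the sub-Laplacian of \<open>reg_G\<close> after a power of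
  \<open>a + r\<close> is split off, with \<open>D\<close> the common value of the carre du champ of
  \<open>b\<close> and of \<open>t\<close>. It is affine in \<open>D\<close> with slope
  \<open>s * (s + 1) * m / r\<close> and vanishes at \<open>D = 2 * b - a\<close>; the deviation
  \<open>- 2 * \<epsilon>\<close> from that value gives the right side.\<close>

lemma regularisation_identity:
  fixes a b r m s D \<epsilon> :: real
  assumes "r > 0" and D: "D = 2 * (b - \<epsilon>) - a"
  shows "(a + r)\<^sup>2 * (s * m * (r - 2 * b) / r ^ 3)
    - 2 * s * (a + r) * (m * ((a + D) / (2 * r\<^sup>2) - (b * a + r * D) / r ^ 3))
    + (m / r) * (- s * (a + r) * (1 + (2 * s * b + D) / r)
        + s * (s + 1) * (a + 2 * (b * a / r) + D))
    = - 2 * \<epsilon> * s * (s + 1) * (m / r)"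
proof -
  \<comment> \<open>Replacing 1/r by \<open>i\<close> with \<open>r * i = 1\<close> makes the claim
    polynomial, so that Groebner bases decide it.\<close>
  define i where "i = 1 / r"
  have ri: "r * i = 1" using assms(1) by (simp add: i_def)
  have "(a + r)\<^sup>2 * (s * m * (r - 2 * b) * i ^ 3)
    - 2 * s * (a + r) * (m * ((a + D) * i\<^sup>2 / 2 - (b * a + r * D) * i ^ 3))
    + (m * i) * (- s * (a + r) * (1 + (2 * s * b + D) * i) + s * (s + 1) * (a + 2 * (b * a * i) + D))
    = - 2 * \<epsilon> * s * (s + 1) * (m * i)"
    using ri D by algebra
  then show ?thesis
    by (simp add: i_def power_divide mult.assoc mult.commute[of "r\<^sup>2" 2])
qed

section \<open>The sub-Laplacian of the regularised function\<close>

context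
  fixes n :: nat and e :: "nat \<Rightarrow> 'm::finite" and \<epsilon> :: real and p :: "(real ^ 'm) \<times> real"
    and J :: "nat set"
  assumes n: "1 \<le> n" and e: "bij_betw e {1..2 * n} UNIV" and \<epsilon>: "0 < \<epsilon>" and J: "J = {1..2 * n}"
begin

abbreviation (input) "lap \<equiv> sum_squares J (heis_X n e)"
abbreviation (input) "car \<equiv> carre J (heis_X n e)"

text \<open>Since \<open>1 - w\<close> is 0 or 1/2, \<open>2 * (1 - w)\<^sup>2 = 1 - w\<close>; in
  the same way \<open>2 * (1 - w) * w = 1 - w\<close> yields \<open>car_a_b\<close>.\<close>

lemma car_a_a: "car (reg_a n e) (reg_a n e) p = reg_a n e p"
  unfolding reg_a_def heis_carre_coord_quad[OF n e, folded J] unfolding coord_quad_def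
  by (intro sum.cong) (auto simp: heis_weight_def)

lemma lie_reg_b:
  assumes "j \<in> J"
  shows "lie (heis_X n e j) (reg_b n e \<epsilon>) = lie (heis_X n e j) (coord_quad n e (heis_weight n))"
  unfolding reg_b_def[abs_def]
  by (intro ext) (simp add: lie_add smooth_const smooth_coord_quad)

lemma car_b: "car (reg_b n e \<epsilon>) f p = car (coord_quad n e (heis_weight n)) f p"
  by (simp add: carre_def lie_reg_b)

lemma car_a_b: "car (reg_a n e) (reg_b n e \<epsilon>) p = reg_a n e p"
  unfolding carre_commute[of _ _ "reg_a n e"] car_b unfolding reg_a_def heis_carre_coord_quad[OF n e, folded J]
  unfolding coord_quad_def
  by (intro sum.cong) (auto simp: heis_weight_def)

text \<open>Both weights, 1/2 and 1, are roots of \<open>2 * w\<^sup>2 - 3 * w + 1\<close>, hence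
  \<open>2 * w\<^sup>2 = 2 * w - (1 - w)\<close>. This is why the second-order calculus closes up in
  the variables a, B and t. The subtraction of \<open>\<epsilon>\<close> undoes the shift contained
  in \<open>reg_b\<close>.\<close>

lemma weight_square_sum:
  "coord_quad n e (\<lambda>j. 2 * (heis_weight n j)\<^sup>2) p = 2 * (reg_b n e \<epsilon> p - \<epsilon>) - reg_a n e p"
proof -
  have "coord_quad n e (\<lambda>j. 2 * (heis_weight n j)\<^sup>2) p =
      (\<Sum>j \<in> J. 2 * (heis_weight n j / 2 * (fst p $ e j)\<^sup>2) - (1 - heis_weight n j) / 2 * (fst p $ e j)\<^sup>2)"
    unfolding coord_quad_def J by (intro sum.cong) (auto simp: heis_weight_def power2_eq_square)
  also have "\<dots> = 2 * coord_quad n e (heis_weight n) p - reg_a n e p"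
    unfolding sum_subtractf sum_distrib_left[symmetric] by (simp only: coord_quad_def reg_a_def J)
  finally show ?thesis by (simp add: reg_b_def)
qed

lemma car_b_b: "car (reg_b n e \<epsilon>) (reg_b n e \<epsilon>) p = 2 * (reg_b n e \<epsilon> p - \<epsilon>) - reg_a n e p"
proof -
  have "car (reg_b n e \<epsilon>) (reg_b n e \<epsilon>) p = car (reg_b n e \<epsilon>) (coord_quad n e (heis_weight n)) p"
    by (subst car_b, rule carre_commute)
  also have "\<dots> = coord_quad n e (\<lambda>j. 2 * (heis_weight n j)\<^sup>2) p"
    unfolding car_b heis_carre_coord_quad[OF n e, folded J] by (simp add: power2_eq_square mult.assoc)
  finally show ?thesis unfolding weight_square_sum .
qed

lemma car_t_t: "car snd snd p = 2 * (reg_b n e \<epsilon> p - \<epsilon>) - reg_a n e p"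
  unfolding weight_square_sum[symmetric] by (rule heis_carre_snd_snd[OF n e, folded J])

lemma car_a_t: "car (reg_a n e) snd p = 0"
  unfolding reg_a_def by (rule heis_carre_coord_quad_snd[OF n e, folded J]) (simp add: weight_partner[OF n e, folded J])

lemma car_b_t: "car (reg_b n e \<epsilon>) snd p = 0"
  unfolding car_b by (rule heis_carre_coord_quad_snd[OF n e, folded J]) (simp add: weight_partner[OF n e, folded J])

lemma lap_a: "lap (reg_a n e) p = 1"
  unfolding reg_a_def heis_lap_coord_quad[OF n e, folded J] by (rule sum_heis_weight(1)[OF n, folded J])

lemma lap_b: "lap (reg_b n e \<epsilon>) p = 2 * real n - 1"
proof -
  have "lap (reg_b n e \<epsilon>) p = lap (coord_quad n e (heis_weight n)) p"
    by (simp add: sum_squares_def lie_reg_b)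
  then show ?thesis
    using heis_lap_coord_quad[OF n e, of "heis_weight n" p, folded J] sum_heis_weight(2)[OF n, folded J] by simp
qed

text \<open>Values of \<open>lap\<close> and \<open>car\<close> at the fixed point \<open>p\<close>
  are expressed by the numbers \<open>a\<close>, \<open>b\<close>, \<open>t\<close>,
  \<open>r\<close>, \<open>m\<close>, \<open>D\<close>, \<open>s\<close>, so that in the end only
  \<open>regularisation_identity\<close> is needed. The functions \<open>F\<close>,
  \<open>W\<close>, \<open>M\<close>, \<open>I\<close>, \<open>q'\<close> name the subexpressions of
  \<open>reg_G\<close> to which the product and power rules apply.\<close>

lemma lap_reg_G:
  "lap (reg_G n e \<epsilon>) p = - 2 * \<epsilon> * (real n - 1 / 2) * (real n + 1 / 2) *
    (reg_h n e \<epsilon> p * (reg_a n e p + reg_r n e \<epsilon> p) powr (- (real n + 3 / 2)))"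
proof -
  note X = divfree_heis_X[OF n e, folded J]
  let ?b = "reg_b n e \<epsilon>" and ?a = "reg_a n e" and ?r = "reg_r n e \<epsilon>"
  define s where "s = real n - 1 / 2"
  define a b t r where "a = ?a p" and "b = ?b p" and "t = snd p" and "r = ?r p"
  define D where "D = 2 * (b - \<epsilon>) - a"
  define m where "m = (b + r) powr (1 / 2)"
  define q where "q = a + r"
  have pos: "0 < b" "0 < r" "0 < b + r" "0 < q" "0 \<le> a"
    unfolding a_def b_def r_def q_def by (rule reg_pos[OF \<epsilon>] reg_a_nonneg)+
  have r2: "b\<^sup>2 + t\<^sup>2 = r\<^sup>2"
    unfolding r_def reg_r_eq by (simp add: b_def t_def)
  have f_pos: "b * b + t * t > 0" using pos by (intro add_pos_nonneg) auto
  have r_eq: "r = (b * b + t * t) powr (1 / 2)"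
    by (simp add: r_def reg_r_def b_def t_def)
  have m_pos: "m > 0" using pos by (simp add: m_def)
  have m2: "m\<^sup>2 = b + r" using pos by (simp add: m_def powr_half_sqrt)
  have t_smooth: "smooth (snd :: (real ^ 'm) \<times> real \<Rightarrow> real)"
    by (rule smooth_linear[OF bounded_linear_snd])
  note sm = smooth_reg[OF \<epsilon>, of n e] t_smooth
  \<comment> \<open>Lowering exponents by natural numbers turns all occurring powers into rational
    expressions in \<open>r\<close>, \<open>m\<close> and \<open>q\<close>.\<close>
  have powr_shift: "x powr (c - real k) = x powr c / x ^ k" if "x > 0" for x c :: real and k
    using that by (simp add: powr_diff powr_realpow)
  have f_powr: "(b * b + t * t) powr (1 / 2 - 1) = 1 / r" "(b * b + t * t) powr (1 / 2 - 2) = 1 / r ^ 3"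
  proof -
    have f: "b * b + t * t = r ^ 2" using r2 by (simp add: power2_eq_square)
    have "(b * b + t * t) powr (1 / 2 - real 1) = r / r ^ 2"
      "(b * b + t * t) powr (1 / 2 - real 2) = r / (r ^ 2) ^ 2"
      unfolding powr_shift[OF f_pos] unfolding r_eq[symmetric] unfolding f by simp_all
    then show "(b * b + t * t) powr (1 / 2 - 1) = 1 / r" "(b * b + t * t) powr (1 / 2 - 2) = 1 / r ^ 3"
      using pos by (simp_all add: field_simps eval_nat_numeral)
  qed
  have m_powr: "(b + r) powr (1 / 2 - 1) = 1 / m" "(b + r) powr (1 / 2 - 2) = 1 / m ^ 3"
  proof -
    have "(b + r) powr (1 / 2 - real 1) = m / m ^ 2"
      "(b + r) powr (1 / 2 - real 2) = m / (m ^ 2) ^ 2"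
      unfolding powr_shift[OF pos(3)] unfolding m_def[symmetric] unfolding m2[symmetric] by simp_all
    then show "(b + r) powr (1 / 2 - 1) = 1 / m" "(b + r) powr (1 / 2 - 2) = 1 / m ^ 3"
      using m_pos by (simp_all add: field_simps eval_nat_numeral)
  qed
  have r_powr: "r powr (- 1) = 1 / r" "r powr (- 1 - 1) = 1 / r ^ 2" "r powr (- 1 - 2) = 1 / r ^ 3"
    using pos powr_shift[of r 0 1] powr_shift[of r 0 2] powr_shift[of r 0 3] by simp_all

  define F where "F = (\<lambda>p. ?b p * ?b p + snd p * snd p)"
  have F: "smooth F" "\<And>p. F p > 0" "F p = b * b + t * t"
    unfolding F_def b_def t_def by (intro smooth_add smooth_mult sm reg_pos(2)[OF \<epsilon>] refl)+
  have r_F: "?r = (\<lambda>p. F p powr (1 / 2))"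
    unfolding reg_r_def[abs_def] F_def ..
  have car_F: "car F f p = 2 * b * car ?b f p + 2 * t * car snd f p" for f
    unfolding F_def by (simp add: carre_add carre_mult smooth_mult sm b_def t_def)
  have car_r: "car ?r f p = (b * car ?b f p + t * car snd f p) / r" for f
  proof -
    have "car ?r f p = 1 / 2 * (1 / r) * (2 * b * car ?b f p + 2 * t * car snd f p)"
      unfolding r_F carre_powr[OF F(1,2)] F(3) f_powr car_F ..
    also have "\<dots> = (b * car ?b f p + t * car snd f p) / r"
      using pos by (simp add: field_simps)
    finally show ?thesis .
  qed
  have car0: "car ?a ?a p = a" "car ?a ?b p = a" "car ?b ?a p = a" "car ?b ?b p = D" "car snd snd p = D"
    "car ?a snd p = 0" "car snd ?a p = 0" "car ?b snd p = 0" "car snd ?b p = 0"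
    using car_a_a car_a_b car_b_b car_t_t car_a_t car_b_t
    unfolding a_def[symmetric] b_def[symmetric] D_def[symmetric]
    by (simp_all add: carre_commute[of _ _ ?b ?a] carre_commute[of _ _ snd ?a] carre_commute[of _ _ snd ?b])
  have lap0: "lap ?a p = 1" "lap ?b p = 2 * s" "lap snd p = 0"
    using lap_a lap_b heis_lap_snd[OF n e, folded J] by (simp_all add: s_def)
  have car_ra: "car ?r ?a p = b * a / r" "car ?a ?r p = b * a / r"
    and car_rb: "car ?r ?b p = b * D / r" "car ?b ?r p = b * D / r"
    and car_rt: "car ?r snd p = t * D / r" "car snd ?r p = t * D / r"
    by (simp_all add: car_r car0 carre_commute[of _ _ ?a ?r] carre_commute[of _ _ ?b ?r]
        carre_commute[of _ _ snd ?r])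
  \<comment> \<open>In the plane (b, t) the carre du champ is \<open>D\<close> times the Euclidean
    one, and the gradient of the modulus \<open>r\<close> has length 1.\<close>
  have car_rr: "car ?r ?r p = D"
  proof -
    have "car ?r ?r p = (b\<^sup>2 + t\<^sup>2) * D / r\<^sup>2"
      unfolding car_r[of ?r] car_rb car_rt using pos by (simp add: field_simps power2_eq_square)
    then show ?thesis using pos by (simp add: r2)
  qed
  have lap_r: "lap ?r p = (2 * s * b + D) / r"
  proof -
    have "lap F p = 4 * s * b + 4 * D"
      unfolding F_def
      by (simp add: sum_squares_add[OF X] sum_squares_mult[OF X] smooth_mult sm lap0 car0)
        (simp add: b_def)
    moreover have "car F F p = 4 * D * r\<^sup>2"
    proof -
      have "car ?b F p = 2 * b * D" "car snd F p = 2 * t * D"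
        unfolding carre_commute[of _ _ ?b F] carre_commute[of _ _ snd F] car_F car0 by simp_all
      then show ?thesis
        unfolding car_F r2[symmetric] by (simp add: algebra_simps power2_eq_square)
    qed
    moreover have "lap ?r p = 1 / 2 * (1 / r) * lap F p + 1 / 2 * (1 / 2 - 1) * (1 / r ^ 3) * car F F p"
      unfolding r_F
      by (subst sum_squares_powr[OF X F(1,2)]) (simp_all only: F(3) f_powr)
    ultimately have "lap ?r p = 1 / 2 * (1 / r) * (4 * s * b + 4 * D)
        + 1 / 2 * (1 / 2 - 1) * (1 / r ^ 3) * (4 * D * r\<^sup>2)"
      by simp
    also have "\<dots> = (2 * s * b + D) / r"
      using pos by (simp add: divide_simps power2_eq_square power3_eq_cube)
    finally show ?thesis .
  qed

  define W where "W = (\<lambda>p. ?b p + ?r p)"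
  define M where "M = (\<lambda>p. W p powr (1 / 2))"
  define I where "I = (\<lambda>p. ?r p powr (- 1))"
  have W: "smooth W" "\<And>p. W p > 0" "W p = b + r"
    unfolding W_def using reg_pos[OF \<epsilon>] by (auto intro!: smooth_add sm simp: b_def r_def)
  have M: "smooth M" "M p = m"
    unfolding M_def by (auto intro!: smooth_powr W simp: W m_def)
  have I: "smooth I" "I p = 1 / r"
    unfolding I_def
    by (intro smooth_powr sm reg_pos(3)[OF \<epsilon>]) (simp only: r_def[symmetric] r_powr)
  have car_W: "car W f p = car ?b f p + car ?r f p" for f
    unfolding W_def by (intro carre_add sm)
  have car_M: "car M f p = car W f p / (2 * m)" for f
    unfolding M_def carre_powr[OF W(1,2)] W(3) m_powr by simp
  have car_I: "car I f p = - car ?r f p / r\<^sup>2" for f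
    unfolding I_def carre_powr[OF sm(3) reg_pos(3)[OF \<epsilon>]] r_def[symmetric] r_powr by simp
  have lap_W: "lap W p = 2 * s + (2 * s * b + D) / r"
    unfolding W_def by (simp add: sum_squares_add[OF X] sm lap0 lap_r)
  have car_WW: "car W W p = 2 * D * m\<^sup>2 / r"
  proof -
    have "car ?b W p = D + b * D / r" "car ?r W p = b * D / r + D"
      unfolding carre_commute[of _ _ ?b W] carre_commute[of _ _ ?r W] car_W car0 car_rb car_rr by simp_all
    then show ?thesis
      unfolding car_W m2 using pos by (simp add: field_simps)
  qed
  have lap_M: "lap M p = s * m / r"
  proof -
    have "lap M p = lap W p / (2 * m) - 1 / 4 * car W W p / m ^ 3"
      unfolding M_def by (subst sum_squares_powr[OF X W(1,2)]) (simp_all only: W(3) m_powr, simp)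
    also have "lap W p = (2 * s * m\<^sup>2 + D) / r"
      unfolding lap_W m2 using pos by (simp add: field_simps)
    finally show ?thesis
      unfolding car_WW using pos m_pos
      by (simp add: field_simps power2_eq_square power3_eq_cube)
  qed
  have lap_I: "lap I p = (D - 2 * s * b) / r ^ 3"
  proof -
    have "lap I p = - (1 / r\<^sup>2 * lap ?r p) + 2 * (1 / r ^ 3) * D"
      unfolding I_def by (subst sum_squares_powr[OF X sm(3) reg_pos(3)[OF \<epsilon>]])
        (simp_all only: r_def[symmetric] r_powr car_rr, simp)
    then show ?thesis
      unfolding lap_r using pos by (simp add: field_simps power2_eq_square power3_eq_cube)
  qed
  have h_eq: "reg_h n e \<epsilon> = (\<lambda>p. M p * I p)"
    unfolding reg_h_def[abs_def] M_def I_def W_def ..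
  have car_MI: "car M I p = - D * m / (2 * r ^ 3)"
  proof -
    have "car M I p = - (b * D / r + D) / (2 * m * r\<^sup>2)"
      unfolding car_M car_W carre_commute[of _ _ ?b I] carre_commute[of _ _ ?r I] car_I car_rb car_rr
      using pos m_pos by (simp add: field_simps)
    also have "\<dots> = - D * m\<^sup>2 / (2 * m * r ^ 3)"
      unfolding m2 using pos m_pos by (simp add: divide_simps power2_eq_square power3_eq_cube) algebra
    finally show ?thesis using m_pos by (simp add: power2_eq_square)
  qed
  \<comment> \<open>All terms in \<open>D\<close> cancel because h is harmonic in (b, t); what
    remains is \<open>2 * s\<close> times the derivative of h with respect to b.\<close>
  have lap_h: "lap (reg_h n e \<epsilon>) p = s * m * (r - 2 * b) / r ^ 3"
    unfolding h_eq
    by (subst sum_squares_mult[OF X M(1) I(1)])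
      (simp_all only: lap_M lap_I car_MI M(2) I(2),
        use pos in \<open>simp add: field_simps power2_eq_square power3_eq_cube\<close>)

  define q' where "q' = (\<lambda>p. ?a p + ?r p)"
  have q': "smooth q'" "\<And>p. q' p > 0" "q' p = q"
    unfolding q'_def q_def using reg_pos[OF \<epsilon>] by (auto intro!: smooth_add sm simp: a_def r_def)
  have car_q: "car q' f p = car ?a f p + car ?r f p" for f
    unfolding q'_def by (intro carre_add sm)
  have lap_q: "lap q' p = 1 + (2 * s * b + D) / r"
    unfolding q'_def by (simp add: sum_squares_add[OF X] sm lap0 lap_r)
  have car_qq: "car q' q' p = a + 2 * (b * a / r) + D"
    unfolding car_q carre_commute[of _ _ ?a q'] carre_commute[of _ _ ?r q'] car0 car_ra car_rr by simp
  have car_qh: "car q' (reg_h n e \<epsilon>) p = m * ((a + D) / (2 * r\<^sup>2) - (b * a + r * D) / r ^ 3)"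
  proof -
    have Mq: "car M q' p = (a + D) * m / (2 * r)"
    proof -
      have "car M q' p = (a + b * a / r + (b * D / r + D)) / (2 * m)"
        unfolding car_M car_W carre_commute[of _ _ ?b q'] carre_commute[of _ _ ?r q'] car_q car0 car_rb car_ra car_rr by simp
      also have "\<dots> = (a + D) * m\<^sup>2 / (2 * m * r)"
        unfolding m2 using pos m_pos by (simp add: field_simps)
      finally show ?thesis using m_pos by (simp add: power2_eq_square)
    qed
    have Iq: "car I q' p = - (b * a / r + D) / r\<^sup>2"
      unfolding car_I carre_commute[of _ _ ?r q'] car_q car_ra car_rr by simp
    have "car q' (reg_h n e \<epsilon>) p = m * car I q' p + 1 / r * car M q' p"
      unfolding h_eq carre_commute[of _ _ q' "\<lambda>p. M p * I p"] carre_mult[OF M(1) I(1)] M(2) I(2) ..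
    then show ?thesis
      unfolding Mq Iq using pos by (simp add: field_simps power2_eq_square power3_eq_cube)
  qed
  \<comment> \<open>The lowest power of \<open>q\<close> that occurs; the others are
    \<open>P\<close> times a power of \<open>q\<close> with natural exponent, so \<open>P\<close>
    factors out.\<close>
  define P where "P = q powr (- s - 2)"
  have q_powr: "q powr (- s) = P * q\<^sup>2" "q powr (- s - 1) = P * q"
    using powr_shift[OF pos(4), of "- s" 2] powr_shift[OF pos(4), of "- s - 1" 1] pos
    by (simp_all add: P_def field_simps)
  have "lap (reg_G n e \<epsilon>) p =
      lap (\<lambda>p. reg_h n e \<epsilon> p * (q' p powr (- s))) p"
    by (simp add: reg_G_def[abs_def] q'_def s_def)
  also have "\<dots> = (m / r) * (- s * (P * q) * lap q' p + s * (s + 1) * P * car q' q' p)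
      + (P * q\<^sup>2) * lap (reg_h n e \<epsilon>) p - 2 * s * (P * q) * car q' (reg_h n e \<epsilon>) p"
  proof -
    have "lap (\<lambda>p. q' p powr (- s)) p = - s * (P * q) * lap q' p + s * (s + 1) * P * car q' q' p"
      by (subst sum_squares_powr[OF X q'(1,2)])
        (simp_all only: q'(3) q_powr P_def[symmetric], simp add: algebra_simps)
    moreover have "car (reg_h n e \<epsilon>) (\<lambda>p. q' p powr (- s)) p = - s * (P * q) * car q' (reg_h n e \<epsilon>) p"
      unfolding carre_commute[of _ _ "reg_h n e \<epsilon>" "\<lambda>p. q' p powr (- s)"] carre_powr[OF q'(1,2)] q'(3)
        q_powr ..
    moreover have "reg_h n e \<epsilon> p = m / r"
      by (simp add: h_eq M I)
    moreover have "lap (\<lambda>p. reg_h n e \<epsilon> p * q' p powr (- s)) p =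
        reg_h n e \<epsilon> p * lap (\<lambda>p. q' p powr (- s)) p + q' p powr (- s) * lap (reg_h n e \<epsilon>) p
          + 2 * car (reg_h n e \<epsilon>) (\<lambda>p. q' p powr (- s)) p"
      by (rule sum_squares_mult[OF X sm(4) smooth_powr[OF q'(1,2)]])
    moreover have "q' p powr (- s) = P * q\<^sup>2"
      unfolding q'(3) by (rule q_powr)
    ultimately show ?thesis by (simp only:)
  qed
  also have "\<dots> = P * (q\<^sup>2 * (s * m * (r - 2 * b) / r ^ 3)
    - 2 * s * q * (m * ((a + D) / (2 * r\<^sup>2) - (b * a + r * D) / r ^ 3))
    + (m / r) * (- s * q * (1 + (2 * s * b + D) / r) + s * (s + 1) * (a + 2 * (b * a / r) + D)))"
    unfolding lap_q car_qq lap_h car_qh by (simp add: algebra_simps)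
  also have "\<dots> = P * (- 2 * \<epsilon> * s * (s + 1) * (m / r))"
    unfolding q_def regularisation_identity[OF pos(2) D_def] ..
  also have "\<dots> = - 2 * \<epsilon> * s * (s + 1) * (m / r * P)"
    by simp
  also have "m / r = reg_h n e \<epsilon> p"
    by (simp add: h_eq M I)
  also have "P = (?a p + ?r p) powr (- (real n + 3 / 2))"
    by (simp add: P_def q_def s_def a_def r_def algebra_simps)
  also have "s + 1 = real n + 1 / 2"
    by (simp add: s_def)
  finally show ?thesis unfolding s_def .
qed

end

section \<open>Integrability\<close>

text \<open>Lebesgue measure on a Euclidean space is the image of a product of Lebesgue measures on
  the line, for which products of integrable functions are integrable.\<close>

lemma integrable_lborel_prod:
  fixes f :: "'a::euclidean_space \<Rightarrow> real \<Rightarrow> real"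
  assumes "\<And>b. b \<in> Basis \<Longrightarrow> integrable lborel (f b)"
  shows "integrable lborel (\<lambda>p::'a. \<Prod>b\<in>Basis. f b (p \<bullet> b))"
proof -
  interpret product_sigma_finite "\<lambda>_::'a. lborel :: real measure"
    by standard
  have [measurable]: "f b \<in> borel_measurable borel" if "b \<in> Basis" for b
    using borel_measurable_integrable[OF assms[OF that]] by simp
  have coord: "(\<Sum>b\<in>Basis. x b *\<^sub>R b) \<bullet> c = x c" if "c \<in> Basis" for x and c :: 'a
    using that by simp
  have "integrable (\<Pi>\<^sub>M b\<in>Basis. lborel) (\<lambda>x. \<Prod>b\<in>(Basis::'a set). f b (x b))"
    by (intro product_integrable_prod assms) auto
  also have "(\<lambda>x. \<Prod>b\<in>(Basis::'a set). f b (x b)) =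
      (\<lambda>x. \<Prod>b\<in>Basis. f b ((\<Sum>b\<in>Basis. x b *\<^sub>R b) \<bullet> b))"
    by (intro ext prod.cong) (simp_all only: coord)
  finally have "integrable (distr (\<Pi>\<^sub>M b\<in>(Basis::'a set). lborel) borel (\<lambda>x. \<Sum>b\<in>Basis. x b *\<^sub>R b))
      (\<lambda>p. \<Prod>b\<in>Basis. f b (p \<bullet> b))"
    by (subst integrable_distr_eq) simp_all
  then show ?thesis by (simp only: lborel_eq[symmetric])
qed

lemma prod_Basis_vec_real:
  fixes F :: "(real ^ 'm) \<times> real \<Rightarrow> real"
  shows "(\<Prod>b\<in>Basis. F b) = (\<Prod>i\<in>UNIV. F (axis i 1, 0)) * F (0, 1)"
proof -
  have B: "(Basis :: ((real ^ 'm) \<times> real) set) = insert (0, 1) (range (\<lambda>i. (axis i 1, 0)))"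
    by (auto simp: Basis_prod_def Basis_vec_def)
  have inj: "inj (\<lambda>i :: 'm. (axis i (1::real), 0 :: real))"
    by (auto simp: inj_def axis_eq_axis)
  have "(0, 1) \<notin> range (\<lambda>i :: 'm. (axis i (1::real), 0 :: real))" by auto
  then show ?thesis
    unfolding B by (subst prod.insert) (auto simp: prod.reindex[OF inj] mult.commute)
qed

lemma integrable_lborel_coords:
  fixes f g :: "real \<Rightarrow> real"
  assumes "integrable lborel f" "integrable lborel g"
  shows "integrable lborel (\<lambda>p :: (real ^ 'm) \<times> real. (\<Prod>i\<in>UNIV. f (fst p $ i)) * g (snd p))"
proof -
  \<comment> \<open>The test on \<open>snd b\<close> separates the spatial basis vectors
    \<open>(axis i 1, 0)\<close> from \<open>(0, 1)\<close>.\<close>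
  define F where "F b = (if snd b = 0 then f else g)" for b :: "(real ^ 'm) \<times> real"
  have "integrable lborel (\<lambda>p :: (real ^ 'm) \<times> real. \<Prod>b\<in>Basis. F b (p \<bullet> b))"
    using assms by (intro integrable_lborel_prod) (simp add: F_def)
  then show ?thesis
    unfolding prod_Basis_vec_real by (simp add: F_def inner_prod_def inner_axis)
qed

lemma integrable_even:
  fixes g :: "real \<Rightarrow> real"
  assumes "set_integrable lborel {0..} g" "\<And>s. 0 \<le> s \<Longrightarrow> 0 \<le> g s"
    "(\<lambda>s. g \<bar>s\<bar>) \<in> borel_measurable borel"
  shows "integrable lborel (\<lambda>s. g \<bar>s\<bar>)"
proof -
  let ?h = "\<lambda>s. indicator {0..} s * g s"
  have h: "integrable lborel ?h"
    using assms(1) by (simp add: set_integrable_def)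
  \<comment> \<open>Adding the reflection gives a bound rather than an equality, since the value at
    0 is counted twice.\<close>
  then have "integrable lborel (\<lambda>s. ?h s + ?h (0 + (- 1) * s))"
    by (intro Bochner_Integration.integrable_add lborel_integrable_real_affine) auto
  then show ?thesis
  proof (rule Bochner_Integration.integrable_bound)
    show "AE s in lborel. norm (g \<bar>s\<bar>) \<le> norm (?h s + ?h (0 + (- 1) * s))"
      using assms(2) by (intro AE_I2) (auto simp: indicator_def abs_if)
  qed (use assms(3) in simp)
qed

text \<open>Carries gauge integrals over to Lebesgue integrals: for nonnegative functions
  integrability is absolute, and Borel measurability allows the descent from the completed
  measure.\<close>

lemma set_integrable_lborel_nonneg:
  fixes f :: "real \<Rightarrow> real"
  assumes "f integrable_on S" "S \<in> sets borel" "f \<in> borel_measurable borel" "\<And>s. s \<in> S \<Longrightarrow> 0 \<le> f s"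
  shows "set_integrable lborel S f"
proof -
  have "integrable lebesgue (\<lambda>s. indicator S s *\<^sub>R f s)"
    using nonnegative_absolutely_integrable_1[OF assms(1,4)] by (simp add: set_integrable_def)
  moreover have "(\<lambda>s. indicator S s *\<^sub>R f s) \<in> borel_measurable lborel"
    using assms(2,3) by simp
  ultimately show ?thesis
    unfolding set_integrable_def by (simp add: integrable_completion)
qed

lemma integrable_powr_near_0:
  fixes c R :: real
  assumes "- 1 < c" "0 \<le> R"
  shows "integrable lborel (\<lambda>s. indicator {- R..R} s * \<bar>s\<bar> powr c)"
proof -
  have "set_integrable lborel {0..R} (\<lambda>s. s powr c)"
    using assms by (intro set_integrable_lborel_nonneg integrable_on_powr_from_0) auto
  then have "set_integrable lborel {0..} (\<lambda>s. indicator {- R..R} s * s powr c)"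
    unfolding set_integrable_def
    by (rule back_subst[of "integrable lborel"]) (use assms in \<open>auto simp: indicator_def\<close>)
  then have "integrable lborel (\<lambda>s. indicator {- R..R} \<bar>s\<bar> * \<bar>s\<bar> powr c)"
    by (rule integrable_even) auto
  then show ?thesis
    by (rule back_subst[of "integrable lborel"])
      (use assms in \<open>auto simp: fun_eq_iff indicator_def abs_le_iff\<close>)
qed

text \<open>Comparison with 1 on the unit interval and with \<open>s powr (2 * c)\<close> beyond it,
  where \<open>2 * c < - 1\<close>.\<close>

lemma integrable_one_plus_square_powr:
  fixes c :: real
  assumes "c < - 1 / 2"
  shows "integrable lborel (\<lambda>s :: real. (1 + s\<^sup>2) powr c)"
proof -
  have "set_integrable lborel {0..1} (\<lambda>s :: real. 1 :: real)"
    by (rule borel_integrable_atLeastAtMost'[OF continuous_on_const])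
  moreover have "set_integrable lborel {1..} (\<lambda>s :: real. s powr (2 * c))"
  proof (intro set_integrable_lborel_nonneg)
    have "((\<lambda>s :: real. s powr (2 * c)) has_integral - (1 powr (2 * c + 1)) / (2 * c + 1)) {1..}"
      using assms by (intro has_integral_powr_to_inf) auto
    then show "(\<lambda>s :: real. s powr (2 * c)) integrable_on {1..}" by blast
  qed auto
  ultimately have "integrable lborel (\<lambda>s :: real. indicator {0..1} s + indicator {1..} s * s powr (2 * c))"
    by (simp add: set_integrable_def)
  then have "set_integrable lborel {0..} (\<lambda>s :: real. (1 + s\<^sup>2) powr c)"
    unfolding set_integrable_def
  proof (rule Bochner_Integration.integrable_bound)
    show "AE s in lborel. norm (indicat_real {0..} s *\<^sub>R (1 + s\<^sup>2) powr c)
        \<le> norm (indicator {0..1} s + indicator {1..} s * s powr (2 * c) :: real)"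
    proof (rule AE_I2)
      fix s :: real
      have "(1 + s\<^sup>2) powr c \<le> 1 powr c" using assms by (intro powr_mono2') auto
      moreover have "(1 + s\<^sup>2) powr c \<le> s powr (2 * c)" if "1 \<le> s"
      proof -
        have "(1 + s\<^sup>2) powr c \<le> (s\<^sup>2) powr c" using assms that by (intro powr_mono2') auto
        also have "(s\<^sup>2) powr c = s powr (2 * c)" using that by (simp add: powr_powr flip: powr_numeral)
        finally show ?thesis .
      qed
      ultimately show "norm (indicat_real {0..} s *\<^sub>R (1 + s\<^sup>2) powr c)
          \<le> norm (indicator {0..1} s + indicator {1..} s * s powr (2 * c) :: real)"
        by (auto simp: indicator_def)
    qed
  qed auto
  then have "integrable lborel (\<lambda>s :: real. (1 + \<bar>s\<bar>\<^sup>2) powr c)"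
    by (rule integrable_even) auto
  then show ?thesis by simp
qed

text \<open>A negative power of \<open>r\<close> is distributed over the coordinates, each share
  being estimated by a lower bound for \<open>r\<close> in one variable. Integrability in many
  variables thus becomes a choice of exponents for integrals on the line.\<close>

lemma powr_le_prod_powr:
  fixes r v :: real and u :: "'m::finite \<Rightarrow> real"
  assumes "0 < r" "\<And>i. 0 < u i" "\<And>i. u i \<le> r" "0 < v" "v \<le> r" "0 \<le> c" "0 \<le> d"
  shows "r powr (- (real CARD('m) * c + d)) \<le> (\<Prod>i\<in>UNIV. u i powr (- c)) * v powr (- d)"
proof -
  have "r powr (- (real CARD('m) * c + d)) = r powr (- c * real CARD('m)) * r powr (- d)"
    by (simp add: powr_add[symmetric] algebra_simps)
  also have "r powr (- c * real CARD('m)) = (\<Prod>i\<in>(UNIV :: 'm set). r powr (- c))"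
    using powr_realpow[of "r powr (- c)" "CARD('m)"] assms(1) by (simp add: powr_powr)
  also have "\<dots> * r powr (- d) \<le> (\<Prod>i\<in>UNIV. u i powr (- c)) * v powr (- d)"
    using assms by (intro mult_mono prod_mono conjI powr_mono2' prod_nonneg) auto
  finally show ?thesis .
qed

section \<open>Bounds by powers of \<open>reg_r\<close> and their integrability\<close>

context
  fixes n :: nat and e :: "nat \<Rightarrow> 'm::finite"
  assumes n: "1 \<le> n" and e: "bij_betw e {1..2 * n} UNIV"
begin

lemma card_index: "CARD('m) = 2 * n"
  using bij_betw_same_card[OF e] by simp

lemma coord_le_reg_b: "\<epsilon> + (fst p $ i)\<^sup>2 / 4 \<le> reg_b n e \<epsilon> p"
proof -
  obtain j where j: "j \<in> {1..2 * n}" "i = e j"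
    using e by (metis UNIV_I bij_betw_imp_surj_on imageE)
  have "(fst p $ i)\<^sup>2 / 4 \<le> heis_weight n j / 2 * (fst p $ e j)\<^sup>2"
    by (auto simp: j heis_weight_def)
  also have "\<dots> \<le> coord_quad n e (heis_weight n) p"
    unfolding coord_quad_def
    using j heis_weight_nonneg by (intro member_le_sum) auto
  finally show ?thesis by (simp add: reg_b_def)
qed

lemma reg_r_bounds:
  assumes "0 \<le> \<epsilon>"
  shows "\<epsilon> + (fst p $ i)\<^sup>2 / 4 \<le> reg_r n e \<epsilon> p" "sqrt (\<epsilon>\<^sup>2 + (snd p)\<^sup>2) \<le> reg_r n e \<epsilon> p"
proof -
  show "\<epsilon> + (fst p $ i)\<^sup>2 / 4 \<le> reg_r n e \<epsilon> p"
    using coord_le_reg_b reg_b_le_r order_trans by blast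
  show "sqrt (\<epsilon>\<^sup>2 + (snd p)\<^sup>2) \<le> reg_r n e \<epsilon> p"
    unfolding reg_r_eq using reg_b_ge[of \<epsilon> n e p] assms by (simp add: power_mono)
qed

text \<open>From b \<le> r follows b + r \<le> 2 r, and dropping a \<ge> 0 increases a negative
  power; the bound depends on r alone.\<close>

lemma reg_h_le:
  assumes "0 \<le> \<epsilon>" "0 < reg_r n e \<epsilon> p"
  shows "0 \<le> reg_h n e \<epsilon> p"
    "0 \<le> c \<Longrightarrow> reg_h n e \<epsilon> p * (reg_a n e p + reg_r n e \<epsilon> p) powr (- c) \<le> sqrt 2 * reg_r n e \<epsilon> p powr (- (c + 1 / 2))"
proof -
  let ?r = "reg_r n e \<epsilon> p"
  show h0: "0 \<le> reg_h n e \<epsilon> p" by (simp add: reg_h_def)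
  assume c: "0 \<le> c"
  have b: "0 \<le> reg_b n e \<epsilon> p" using reg_b_ge[of \<epsilon> n e p] assms by simp
  have "(reg_b n e \<epsilon> p + ?r) powr (1 / 2) \<le> (2 * ?r) powr (1 / 2)"
    using reg_b_le_r[of n e \<epsilon> p] b assms by (intro powr_mono2) auto
  then have "reg_h n e \<epsilon> p \<le> (2 * ?r) powr (1 / 2) * ?r powr (- 1)"
    unfolding reg_h_def by (intro mult_right_mono) auto
  also have "\<dots> = sqrt 2 * ?r powr (- 1 / 2)"
  proof -
    have "?r powr (1 / 2) * ?r powr (- 1) = ?r powr (- 1 / 2)"
      unfolding powr_add[symmetric] by simp
    then show ?thesis
      using assms(2) by (simp only: powr_mult powr_half_sqrt[of 2, simplified] mult.assoc)
  qed
  finally have "reg_h n e \<epsilon> p \<le> sqrt 2 * ?r powr (- 1 / 2)" .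
  moreover have "(reg_a n e p + ?r) powr (- c) \<le> ?r powr (- c)"
    using assms c reg_a_nonneg[of n e p] by (intro powr_mono2') auto
  ultimately have "reg_h n e \<epsilon> p * (reg_a n e p + ?r) powr (- c) \<le>
      (sqrt 2 * ?r powr (- 1 / 2)) * ?r powr (- c)"
    using h0 by (intro mult_mono) auto
  also have "\<dots> = sqrt 2 * ?r powr (- (c + 1 / 2))"
    by (simp add: mult.assoc powr_add[symmetric] algebra_simps)
  finally show "reg_h n e \<epsilon> p * (reg_a n e p + ?r) powr (- c) \<le> sqrt 2 * ?r powr (- (c + 1 / 2))" .
qed

lemma reg_borel [measurable]:
  "reg_a n e \<in> borel_measurable borel" "reg_b n e \<epsilon> \<in> borel_measurable borel"
  "reg_r n e \<epsilon> \<in> borel_measurable borel" "reg_h n e \<epsilon> \<in> borel_measurable borel"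
  "reg_G n e \<epsilon> \<in> borel_measurable borel"
proof -
  show [measurable]: "reg_a n e \<in> borel_measurable borel"
    unfolding reg_a_def
    by (intro borel_measurable_continuous_onI smooth_continuous smooth_coord_quad)
  have [measurable]: "coord_quad n e w \<in> borel_measurable borel" for w
    by (intro borel_measurable_continuous_onI smooth_continuous smooth_coord_quad)
  have [measurable]: "(snd :: (real ^ 'm) \<times> real \<Rightarrow> real) \<in> borel_measurable borel"
    by (intro borel_measurable_continuous_onI continuous_intros)
  show b [measurable]: "reg_b n e \<epsilon> \<in> borel_measurable borel"
    unfolding reg_b_def[abs_def] by measurable
  show r [measurable]: "reg_r n e \<epsilon> \<in> borel_measurable borel"
    unfolding reg_r_def[abs_def] by measurable
  show [measurable]: "reg_h n e \<epsilon> \<in> borel_measurable borel"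
    unfolding reg_h_def[abs_def] by measurable
  show "reg_G n e \<epsilon> \<in> borel_measurable borel"
    unfolding reg_G_def[abs_def] by measurable
qed

lemma integrable_reg_r_1: "integrable lborel (\<lambda>p. reg_r n e 1 p powr (- (real n + 2)))"
proof -
  \<comment> \<open>Each of the \<open>2 * n\<close> spatial coordinates receives the share
    \<open>c\<close> and \<open>t\<close> the rest, 3/2. As \<open>c > 1 / 2\<close> and
    \<open>3 / 2 > 1\<close>, every one-variable factor is integrable at infinity.\<close>
  define c where "c = 1 / 2 + 1 / (4 * real n)"
  have c: "real CARD('m) * c + 3 / 2 = real n + 2" "0 \<le> c"
    using n by (simp_all add: c_def card_index field_simps)
  have "integrable lborel (\<lambda>s :: real. ((1 + s\<^sup>2) / 4) powr (- c))"
  proof -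
    have "integrable lborel (\<lambda>s :: real. (1 / 4) powr (- c) * (1 + s\<^sup>2) powr (- c))"
      using n by (intro integrable_mult_right integrable_one_plus_square_powr) (simp add: c_def)
    then show ?thesis
      by (simp flip: powr_mult)
  qed
  moreover have "integrable lborel (\<lambda>s :: real. sqrt (1 + s\<^sup>2) powr (- (3 / 2)))"
  proof -
    have "sqrt (1 + s\<^sup>2) powr (- (3 / 2)) = (1 + s\<^sup>2) powr (- (3 / 4))" for s :: real
      by (simp add: powr_half_sqrt[symmetric] powr_powr)
    then show ?thesis using integrable_one_plus_square_powr[of "- (3 / 4)"] by simp
  qed
  ultimately have "integrable lborel (\<lambda>p :: (real ^ 'm) \<times> real.
      (\<Prod>i\<in>UNIV. ((1 + (fst p $ i)\<^sup>2) / 4) powr (- c)) * sqrt (1 + (snd p)\<^sup>2) powr (- (3 / 2)))"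
    by (rule integrable_lborel_coords)
  then show ?thesis
  proof (rule Bochner_Integration.integrable_bound)
    show "AE p in lborel. norm (reg_r n e 1 p powr (- (real n + 2))) \<le>
        norm ((\<Prod>i\<in>UNIV. ((1 + (fst p $ i)\<^sup>2) / 4) powr (- c)) * sqrt (1 + (snd p)\<^sup>2) powr (- (3 / 2)))"
    proof (rule AE_I2)
      fix p :: "(real ^ 'm) \<times> real"
      have "reg_r n e 1 p powr (- (real CARD('m) * c + 3 / 2)) \<le>
          (\<Prod>i\<in>UNIV. ((1 + (fst p $ i)\<^sup>2) / 4) powr (- c)) * sqrt (1 + (snd p)\<^sup>2) powr (- (3 / 2))"
      proof (rule powr_le_prod_powr)
        show "(1 + (fst p $ i)\<^sup>2) / 4 \<le> reg_r n e 1 p" for i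
          using reg_r_bounds(1)[of 1 p i] by (simp add: add_divide_distrib)
        show "sqrt (1 + (snd p)\<^sup>2) \<le> reg_r n e 1 p"
          using reg_r_bounds(2)[of 1 p] by simp
        show "0 < reg_r n e 1 p" by (rule reg_pos) simp
      qed (use c in \<open>auto simp: add_pos_nonneg\<close>)
      then show "norm (reg_r n e 1 p powr (- (real n + 2))) \<le>
        norm ((\<Prod>i\<in>UNIV. ((1 + (fst p $ i)\<^sup>2) / 4) powr (- c)) * sqrt (1 + (snd p)\<^sup>2) powr (- (3 / 2)))"
        unfolding c by (simp add: abs_mult prod_nonneg)
    qed
  qed measurable
qed

lemma reg_r_0_pos:
  assumes "p \<noteq> 0"
  shows "0 < reg_r n e 0 p"
proof (cases "snd p = 0")
  case True
  then have "fst p \<noteq> 0" using assms by (auto simp: prod_eq_iff)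
  then obtain i where "fst p $ i \<noteq> 0" by (auto simp: vec_eq_iff)
  then have "0 < (fst p $ i)\<^sup>2 / 4" by simp
  then show ?thesis using reg_r_bounds(1)[of 0 p i] by linarith
next
  case False
  then have "0 < sqrt (0\<^sup>2 + (snd p)\<^sup>2)" by simp
  then show ?thesis using reg_r_bounds(2)[of 0 p] by linarith
qed

lemma locally_integrable_reg_r_0: "locally_integrable (\<lambda>p. reg_r n e 0 p powr (- real n))"
  unfolding locally_integrable_def
proof (intro allI impI)
  fix K :: "((real ^ 'm) \<times> real) set"
  assume K: "compact K"
  then obtain R where R: "0 < R" "\<And>p. p \<in> K \<Longrightarrow> norm p \<le> R"
    using compact_imp_bounded bounded_pos by metis
  \<comment> \<open>Now \<open>t\<close> receives 1/2 and the spatial coordinates share the rest: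
    the exponents \<open>2 * c\<close> and 1/2 are below 1, so each factor is integrable near
    0.\<close>
  define c where "c = 1 / 2 - 1 / (4 * real n)"
  have c: "real CARD('m) * c + 1 / 2 = real n" "0 \<le> c" "2 * c < 1"
    using n by (simp_all add: c_def card_index field_simps)
  let ?f = "\<lambda>s :: real. indicator {- R..R} s * (s\<^sup>2 / 4) powr (- c)"
  let ?g = "\<lambda>s :: real. indicator {- R..R} s * \<bar>s\<bar> powr (- (1 / 2)) :: real"
  have "integrable lborel ?f"
  proof -
    have "?f s = (1 / 4) powr (- c) * (indicator {- R..R} s * \<bar>s\<bar> powr (- 2 * c))" for s
    proof -
      have "(s\<^sup>2 / 4) powr (- c) = (1 / 4) powr (- c) * (s\<^sup>2) powr (- c)"
        by (simp flip: powr_mult)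
      also have "(s\<^sup>2) powr (- c) = (\<bar>s\<bar> powr 2) powr (- c)"
        by (cases "s = 0") auto
      finally show ?thesis by (simp only: powr_powr) (simp add: algebra_simps)
    qed
    then show ?thesis
      using R(1) c by (simp only:) (intro integrable_mult_right integrable_powr_near_0, auto)
  qed
  moreover have "integrable lborel ?g"
    using R(1) by (intro integrable_powr_near_0) auto
  ultimately have "integrable lborel (\<lambda>p :: (real ^ 'm) \<times> real. (\<Prod>i\<in>UNIV. ?f (fst p $ i)) * ?g (snd p))"
    by (rule integrable_lborel_coords)
  then show "set_integrable lborel K (\<lambda>p. reg_r n e 0 p powr (- real n))"
    unfolding set_integrable_def
  proof (rule Bochner_Integration.integrable_bound)
    have "K \<in> sets borel" using K by (simp add: compact_imp_closed)
    then show "(\<lambda>p. indicator K p *\<^sub>R reg_r n e 0 p powr (- real n)) \<in> borel_measurable lborel"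
      by measurable
    \<comment> \<open>On a coordinate hyperplane a factor of the majorant has the default value
      \<open>0 powr c = 0\<close>, and the estimate would break down there.\<close>
    have AE: "AE p :: (real ^ 'm) \<times> real in lborel. \<forall>b\<in>Basis. p \<bullet> b \<noteq> 0"
      by (intro AE_ball_countable' AE_lborel_inner_neq countable_finite) auto
    show "AE p in lborel. norm (indicator K p *\<^sub>R reg_r n e 0 p powr (- real n)) \<le>
        norm ((\<Prod>i\<in>UNIV. ?f (fst p $ i)) * ?g (snd p))"
      using AE
    proof eventually_elim
      case (elim p)
      have t: "snd p \<noteq> 0"
        using elim[rule_format, of "(0, 1)"] by (simp add: Basis_prod_def inner_prod_def)
      have x: "fst p $ i \<noteq> 0" for i
        using elim[rule_format, of "(axis i 1, 0)"]
        by (auto simp: Basis_prod_def inner_prod_def inner_axis Basis_vec_def)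
      show ?case
      proof (cases "p \<in> K")
        case True
        have "\<bar>fst p $ i\<bar> \<le> R" for i
          using R(2)[OF True] component_le_norm_cart[of "fst p" i] norm_fst_le[of "fst p" "snd p"] by simp
        then have i1: "indicator {- R..R} (fst p $ i) = (1 :: real)" for i
          by (auto simp: indicator_def abs_le_iff minus_le_iff)
        have "\<bar>snd p\<bar> \<le> R"
          using R(2)[OF True] norm_snd_le[of "snd p" "fst p"] by simp
        then have i2: "indicator {- R..R} (snd p) = (1 :: real)"
          by (auto simp: indicator_def)
        have "reg_r n e 0 p powr (- (real CARD('m) * c + 1 / 2)) \<le>
          (\<Prod>i\<in>UNIV. ((fst p $ i)\<^sup>2 / 4) powr (- c)) * \<bar>snd p\<bar> powr (- (1 / 2))"
        proof (rule powr_le_prod_powr)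
          show "0 < reg_r n e 0 p" using t by (intro reg_r_0_pos) auto
          show "(fst p $ i)\<^sup>2 / 4 \<le> reg_r n e 0 p" for i
            using reg_r_bounds(1)[of 0 p i] by simp
          show "\<bar>snd p\<bar> \<le> reg_r n e 0 p"
            using reg_r_bounds(2)[of 0 p] by simp
        qed (use c t x in auto)
        then show ?thesis
          unfolding c using True by (simp add: i1 i2 abs_mult prod_nonneg)
      qed simp
    qed
  qed
qed

end

section \<open>Dilations\<close>

text \<open>The exponent is the homogeneous dimension: \<open>t\<close> scales by
  \<open>l\<^sup>2\<close> and thus counts twice.\<close>

lemma integral_heis_dilation:
  fixes f :: "(real ^ 'm) \<times> real \<Rightarrow> real"
  assumes "0 < l" and [measurable]: "f \<in> borel_measurable borel"
  shows "(\<integral>p. f p \<partial>lborel) = l ^ (CARD('m) + 2) * (\<integral>p. f (heis_dilation l p) \<partial>lborel)"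
proof -
  define c where "c b = (if snd b = 0 then l else l\<^sup>2)" for b :: "(real ^ 'm) \<times> real"
  have T: "0 + (\<Sum>j\<in>Basis. (c j * (p \<bullet> j)) *\<^sub>R j) = heis_dilation l p" for p
  proof (rule euclidean_eqI)
    fix b :: "(real ^ 'm) \<times> real"
    assume b: "b \<in> Basis"
    have "heis_dilation l p \<bullet> b = c b * (p \<bullet> b)"
      using b by (auto simp: Basis_prod_def heis_dilation_def c_def inner_prod_def)
    then show "(0 + (\<Sum>j\<in>Basis. (c j * (p \<bullet> j)) *\<^sub>R j)) \<bullet> b = heis_dilation l p \<bullet> b"
      using b by simp
  qed
  have [measurable]: "heis_dilation l \<in> borel_measurable (borel :: ((real ^ 'm) \<times> real) measure)"
    unfolding heis_dilation_def[abs_def]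
    by (intro borel_measurable_continuous_onI continuous_intros)
  have "\<And>b. b \<in> Basis \<Longrightarrow> c b \<noteq> 0"
    using assms(1) by (simp add: c_def)
  then have "(lborel :: ((real ^ 'm) \<times> real) measure) =
      density (distr lborel borel (heis_dilation l)) (\<lambda>_. (\<Prod>j\<in>Basis. \<bar>c j\<bar>))"
    using lborel_affine_euclidean[of c 0, unfolded T] by blast
  also have "(\<Prod>j\<in>Basis. \<bar>c j\<bar>) = l ^ (CARD('m) + 2)"
    using assms(1) by (simp add: prod_Basis_vec_real c_def power2_eq_square)
  finally have "(\<integral>p. f p \<partial>lborel) =
      (\<integral>p. f p \<partial>density (distr lborel borel (heis_dilation l)) (\<lambda>_. ennreal (l ^ (CARD('m) + 2))))"
    by simp
  also have "\<dots> = (\<integral>p. l ^ (CARD('m) + 2) *\<^sub>R f p \<partial>distr lborel borel (heis_dilation l))"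
    using assms(1) by (intro integral_density) auto
  also have "\<dots> = (\<integral>p. l ^ (CARD('m) + 2) *\<^sub>R f (heis_dilation l p) \<partial>lborel)"
    by (intro integral_distr) auto
  finally show ?thesis by simp
qed

lemma coord_quad_dilation: "coord_quad n e w (heis_dilation l p) = l\<^sup>2 * coord_quad n e w p"
  by (simp add: coord_quad_def heis_dilation_def sum_distrib_left power_mult_distrib mult_ac)

lemma reg_a_dilation: "reg_a n e (heis_dilation l p) = l\<^sup>2 * reg_a n e p"
  by (simp add: reg_a_def coord_quad_dilation)

text \<open>The parameter \<open>\<epsilon>\<close> scales like B, so dilations permute the
  regularised family.\<close>

lemma reg_b_dilation: "reg_b n e (l\<^sup>2 * \<epsilon>) (heis_dilation l p) = l\<^sup>2 * reg_b n e \<epsilon> p"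
  by (simp add: reg_b_def coord_quad_dilation algebra_simps)

lemma reg_r_dilation: "reg_r n e (l\<^sup>2 * \<epsilon>) (heis_dilation l p) = l\<^sup>2 * reg_r n e \<epsilon> p"
proof -
  have "(l\<^sup>2 * reg_b n e \<epsilon> p)\<^sup>2 + (snd (heis_dilation l p))\<^sup>2 = (l\<^sup>2)\<^sup>2 * ((reg_b n e \<epsilon> p)\<^sup>2 + (snd p)\<^sup>2)"
    by (simp add: heis_dilation_def algebra_simps power_mult_distrib)
  then show ?thesis
    unfolding reg_r_eq reg_b_dilation by (simp only: real_sqrt_mult real_sqrt_abs) simp
qed

text \<open>By \<open>lap_reg_G\<close> this is the sub-Laplacian of \<open>reg_G\<close> without
  its constant and the factor \<open>\<epsilon>\<close>.\<close>

definition reg_psi :: "nat \<Rightarrow> (nat \<Rightarrow> 'm::finite) \<Rightarrow> real \<Rightarrow> (real ^ 'm) \<times> real \<Rightarrow> real" where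
  "reg_psi n e \<epsilon> p = reg_h n e \<epsilon> p * (reg_a n e p + reg_r n e \<epsilon> p) powr (- (real n + 3 / 2))"

text \<open>The degrees of the three powers add up to 1 - 2 - (2 n + 3) = -(2 n + 4).\<close>

lemma reg_psi_dilation:
  assumes "0 < l" "0 \<le> \<epsilon>"
  shows "reg_psi n e (l\<^sup>2 * \<epsilon>) (heis_dilation l p) = reg_psi n e \<epsilon> p / l ^ (2 * n + 4)"
proof -
  let ?b = "reg_b n e \<epsilon> p" and ?r = "reg_r n e \<epsilon> p" and ?a = "reg_a n e p"
  have nn: "0 \<le> ?b" "0 \<le> ?r" "0 \<le> ?a"
    using reg_b_ge[of \<epsilon> n e p] assms reg_a_nonneg[of n e p] by (auto simp: reg_r_eq)
  have "reg_psi n e (l\<^sup>2 * \<epsilon>) (heis_dilation l p) =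
      (l\<^sup>2 * (?b + ?r)) powr (1 / 2) * (l\<^sup>2 * ?r) powr (- 1) * (l\<^sup>2 * (?a + ?r)) powr (- (real n + 3 / 2))"
    unfolding reg_psi_def reg_h_def reg_a_dilation reg_b_dilation reg_r_dilation
    by (simp only: distrib_left)
  also have "\<dots> = ((l\<^sup>2) powr (1 / 2) * (l\<^sup>2) powr (- 1) * (l\<^sup>2) powr (- (real n + 3 / 2))) * reg_psi n e \<epsilon> p"
    unfolding reg_psi_def reg_h_def using nn by (simp only: powr_mult) (simp only: mult_ac)
  also have "(l\<^sup>2) powr (1 / 2) * (l\<^sup>2) powr (- 1) * (l\<^sup>2) powr (- (real n + 3 / 2)) = (l\<^sup>2) powr (- real (n + 2))"
    unfolding powr_add[symmetric] by (rule arg_cong[where f = "(powr) (l\<^sup>2)"]) simp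
  also have "\<dots> = inverse ((l\<^sup>2) powr real (n + 2))"
    by (rule powr_minus)
  also have "(l\<^sup>2) powr real (n + 2) = (l\<^sup>2) ^ (n + 2)"
    using assms(1) by (intro powr_realpow) simp
  also have "\<dots> = l ^ (2 * n + 4)"
    unfolding power_mult[symmetric] by (rule arg_cong[where f = "(^) l"]) simp
  finally show ?thesis by (simp add: divide_inverse)
qed

section \<open>Passage to the limit\<close>

context
  fixes n :: nat and e :: "nat \<Rightarrow> 'm::finite"
  assumes n: "1 \<le> n" and e: "bij_betw e {1..2 * n} UNIV"
begin

lemma reg_psi_borel [measurable]: "reg_psi n e \<epsilon> \<in> borel_measurable borel"
proof -
  note [measurable] = reg_borel[OF n e]
  show ?thesis unfolding reg_psi_def[abs_def] by measurable
qed

lemma reg_psi_1_pos: "0 < reg_psi n e 1 p"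
  unfolding reg_psi_def reg_h_def using reg_pos(3-5)[of 1 n e p] by simp

lemma integrable_reg_psi_1: "integrable lborel (reg_psi n e 1)"
proof (rule Bochner_Integration.integrable_bound)
  show "integrable lborel (\<lambda>p. sqrt 2 * reg_r n e 1 p powr (- (real n + 2)))"
    by (intro integrable_mult_right integrable_reg_r_1[OF n e])
  show "AE p in lborel. norm (reg_psi n e 1 p) \<le> norm (sqrt 2 * reg_r n e 1 p powr (- (real n + 2)))"
  proof (rule AE_I2)
    fix p
    have "reg_psi n e 1 p \<le> sqrt 2 * reg_r n e 1 p powr (- (real n + 3 / 2 + 1 / 2))"
      unfolding reg_psi_def by (intro reg_h_le[OF n e] reg_pos) auto
    then show "norm (reg_psi n e 1 p) \<le> norm (sqrt 2 * reg_r n e 1 p powr (- (real n + 2)))"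
      using reg_psi_1_pos[of p] by (simp add: algebra_simps)
  qed
qed simp

text \<open>The density is strictly positive and the whole space is not a null set. This makes the
  multiple of the Dirac distribution nonzero.\<close>

lemma integral_reg_psi_1_pos: "0 < (\<integral>p. reg_psi n e 1 p \<partial>lborel)"
proof -
  have "\<not> (AE p in lborel. reg_psi n e 1 p = 0)"
  proof
    assume "AE p in lborel. reg_psi n e 1 p = 0"
    then have "AE p in (lborel :: ((real ^ 'm) \<times> real) measure). False"
      by eventually_elim (use reg_psi_1_pos less_irrefl in metis)
    then show False
      by (simp add: eventually_False ae_filter_eq_bot_iff)
  qed
  then have "(\<integral>p. reg_psi n e 1 p \<partial>lborel) \<noteq> 0"
    using integral_nonneg_eq_0_iff_AE[OF integrable_reg_psi_1 AE_I2[OF less_imp_le[OF reg_psi_1_pos]]]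
    by blast
  moreover have "0 \<le> (\<integral>p. reg_psi n e 1 p \<partial>lborel)"
    by (intro integral_nonneg_AE AE_I2 less_imp_le reg_psi_1_pos)
  ultimately show ?thesis by simp
qed

text \<open>Since r grows with \<open>\<epsilon>\<close>, its negative powers are largest at
  \<open>\<epsilon> = 0\<close>; this gives a majorant independent of
  \<open>\<epsilon>\<close>.\<close>

lemma reg_G_le:
  assumes "0 \<le> \<epsilon>" "p \<noteq> 0"
  shows "0 \<le> reg_G n e \<epsilon> p" "reg_G n e \<epsilon> p \<le> sqrt 2 * reg_r n e 0 p powr (- real n)"
proof -
  have r0: "0 < reg_r n e 0 p" by (rule reg_r_0_pos[OF n e assms(2)])
  have "reg_b n e 0 p \<le> reg_b n e \<epsilon> p" "0 \<le> reg_b n e 0 p"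
    using assms(1) reg_b_ge[of 0 n e p] by (auto simp: reg_b_def)
  then have r: "reg_r n e 0 p \<le> reg_r n e \<epsilon> p"
    unfolding reg_r_eq by (simp add: power_mono)
  show "0 \<le> reg_G n e \<epsilon> p" by (simp add: reg_G_def reg_h_def)
  have "reg_G n e \<epsilon> p \<le> sqrt 2 * reg_r n e \<epsilon> p powr (- (real n - 1 / 2 + 1 / 2))"
    unfolding reg_G_def using r r0 n assms(1) by (intro reg_h_le[OF n e]) auto
  also have "\<dots> \<le> sqrt 2 * reg_r n e 0 p powr (- (real n - 1 / 2 + 1 / 2))"
    using r r0 n by (intro mult_left_mono powr_mono2') auto
  finally show "reg_G n e \<epsilon> p \<le> sqrt 2 * reg_r n e 0 p powr (- real n)" by simp
qed

lemma reg_G_at_0: "reg_G n e 0 0 = 0"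
  by (simp add: reg_G_def reg_h_def reg_r_def reg_b_def coord_quad_def)

lemma locally_integrable_reg_G_0: "locally_integrable (reg_G n e 0)"
  unfolding locally_integrable_def
proof (intro allI impI)
  fix K :: "((real ^ 'm) \<times> real) set"
  assume K: "compact K"
  have "set_integrable lborel K (\<lambda>p. reg_r n e 0 p powr (- real n))"
    using locally_integrable_reg_r_0[OF n e] K by (simp add: locally_integrable_def)
  then have "integrable lborel (\<lambda>p. sqrt 2 * (indicator K p *\<^sub>R reg_r n e 0 p powr (- real n)))"
    unfolding set_integrable_def by (rule integrable_mult_right)
  then show "set_integrable lborel K (reg_G n e 0)"
    unfolding set_integrable_def
  proof (rule Bochner_Integration.integrable_bound)
    have "K \<in> sets borel" using K by (simp add: compact_imp_closed)
    then show "(\<lambda>p. indicator K p *\<^sub>R reg_G n e 0 p) \<in> borel_measurable lborel"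
      using reg_borel[OF n e] by simp
    show "AE p in lborel. norm (indicator K p *\<^sub>R reg_G n e 0 p) \<le>
        norm (sqrt 2 * (indicator K p *\<^sub>R reg_r n e 0 p powr (- real n)))"
    proof (rule AE_I2)
      fix p
      show "norm (indicator K p *\<^sub>R reg_G n e 0 p) \<le>
          norm (sqrt 2 * (indicator K p *\<^sub>R reg_r n e 0 p powr (- real n)))"
        using reg_G_le[of 0 p] reg_G_at_0 by (cases "p = 0") (auto simp: indicator_def)
    qed
  qed
qed

lemma reg_G_tendsto:
  assumes "p \<noteq> 0" "\<epsilon> \<longlonglongrightarrow> 0"
  shows "(\<lambda>k. reg_G n e (\<epsilon> k) p) \<longlonglongrightarrow> reg_G n e 0 p"
proof -
  have r0: "0 < reg_r n e 0 p" by (rule reg_r_0_pos[OF n e assms(1)])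
  have b0: "0 \<le> reg_b n e 0 p" by (rule reg_b_ge)
  have a0: "0 \<le> reg_a n e p" by (rule reg_a_nonneg)
  have b: "(\<lambda>k. reg_b n e (\<epsilon> k) p) \<longlonglongrightarrow> reg_b n e 0 p"
    unfolding reg_b_def by (intro tendsto_intros assms)
  have r: "(\<lambda>k. reg_r n e (\<epsilon> k) p) \<longlonglongrightarrow> reg_r n e 0 p"
    unfolding reg_r_eq by (intro tendsto_intros b)
  show ?thesis
    unfolding reg_G_def reg_h_def using r0 b0 a0 by (intro tendsto_intros b r) auto
qed

text \<open>With \<open>\<epsilon> = l\<^sup>2\<close>, substituting the dilation of ratio
  \<open>l\<close> produces \<open>l ^ (2 * n + 2)\<close> from the volume and the inverse of
  \<open>l ^ (2 * n + 4)\<close> from the density, which cancel against the prefactor. The density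
  becomes fixed and only the argument of \<open>\<phi>\<close> shrinks to the origin.\<close>

lemma integral_reg_psi_tendsto:
  assumes \<phi>: "\<phi> \<in> test_functions" and l: "\<And>k. 0 < l k" "l \<longlonglongrightarrow> 0"
  shows "(\<lambda>k. (l k)\<^sup>2 * (\<integral>p. reg_psi n e ((l k)\<^sup>2) p * \<phi> p \<partial>lborel)) \<longlonglongrightarrow>
    \<phi> 0 * (\<integral>p. reg_psi n e 1 p \<partial>lborel)"
proof -
  note [measurable] = test_borel[OF \<phi>]
  have card: "CARD('m) = 2 * n" by (rule card_index[OF n e])
  have eq: "(l k)\<^sup>2 * (\<integral>p. reg_psi n e ((l k)\<^sup>2) p * \<phi> p \<partial>lborel) =
      (\<integral>p. reg_psi n e 1 p * \<phi> (heis_dilation (l k) p) \<partial>lborel)" for k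
  proof -
    have "(\<integral>p. reg_psi n e ((l k)\<^sup>2) p * \<phi> p \<partial>lborel) =
        l k ^ (CARD('m) + 2) * (\<integral>p. reg_psi n e ((l k)\<^sup>2) (heis_dilation (l k) p) * \<phi> (heis_dilation (l k) p) \<partial>lborel)"
      by (rule integral_heis_dilation[OF l(1)]) measurable
    also have "(\<lambda>p. reg_psi n e ((l k)\<^sup>2) (heis_dilation (l k) p) * \<phi> (heis_dilation (l k) p)) =
        (\<lambda>p. 1 / l k ^ (2 * n + 4) * (reg_psi n e 1 p * \<phi> (heis_dilation (l k) p)))"
      using reg_psi_dilation[OF l(1), of 1 n e k] by auto
    finally show ?thesis
      using l(1)[of k] by (simp add: card power_add field_simps eval_nat_numeral)
  qed
  obtain M R where M: "0 \<le> M" "0 < R" "\<And>p. \<bar>\<phi> p\<bar> \<le> M * indicator (cball 0 R) p"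
    using test_bounded[OF \<phi>] by metis
  have \<phi>_le: "\<bar>\<phi> p\<bar> \<le> M" for p
    using M(3)[of p] M(1) by (cases "p \<in> cball 0 R") auto
  have dil [measurable]: "heis_dilation s \<in> borel_measurable (borel :: ((real ^ 'm) \<times> real) measure)" for s
    unfolding heis_dilation_def[abs_def]
    by (intro borel_measurable_continuous_onI continuous_intros)
  have "(\<lambda>k. \<integral>p. reg_psi n e 1 p * \<phi> (heis_dilation (l k) p) \<partial>lborel) \<longlonglongrightarrow>
      (\<integral>p. reg_psi n e 1 p * \<phi> 0 \<partial>lborel)"
  proof (rule integral_dominated_convergence)
    show "integrable lborel (\<lambda>p. M * reg_psi n e 1 p)"
      by (intro integrable_mult_right integrable_reg_psi_1)
    show "AE p in lborel. norm (reg_psi n e 1 p * \<phi> (heis_dilation (l k) p)) \<le> M * reg_psi n e 1 p" for k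
      using \<phi>_le reg_psi_1_pos by (intro AE_I2) (simp add: abs_mult mult.commute mult_right_mono less_imp_le)
    show "AE p in lborel. (\<lambda>k. reg_psi n e 1 p * \<phi> (heis_dilation (l k) p)) \<longlonglongrightarrow> reg_psi n e 1 p * \<phi> 0"
    proof (rule AE_I2)
      fix p :: "(real ^ 'm) \<times> real"
      have "(\<lambda>k. heis_dilation (l k) p) \<longlonglongrightarrow> (0 *\<^sub>R fst p, 0\<^sup>2 * snd p)"
        unfolding heis_dilation_def by (intro tendsto_intros l)
      moreover have "isCont \<phi> 0"
        using smooth_continuous[OF test_functionD(1)[OF \<phi>], of UNIV]
        unfolding continuous_on_eq_continuous_at[OF open_UNIV] by blast
      ultimately have "(\<lambda>k. \<phi> (heis_dilation (l k) p)) \<longlonglongrightarrow> \<phi> 0"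
        by (intro isCont_tendsto_compose[of 0 \<phi>]) (simp_all add: zero_prod_def)
      then show "(\<lambda>k. reg_psi n e 1 p * \<phi> (heis_dilation (l k) p)) \<longlonglongrightarrow> reg_psi n e 1 p * \<phi> 0"
        by (rule tendsto_mult_left)
    qed
  qed measurable
  then show ?thesis unfolding eq by (simp add: mult.commute)
qed

lemma integral_reg_G_0:
  assumes \<phi>: "\<phi> \<in> test_functions"
  shows "(\<integral>p. reg_G n e 0 p * sum_squares {1..2 * n} (heis_X n e) \<phi> p \<partial>lborel) =
    (- 2 * (real n - 1 / 2) * (real n + 1 / 2) * (\<integral>p. reg_psi n e 1 p \<partial>lborel)) * \<phi> 0"
proof -
  let ?L = "sum_squares {1..2 * n} (heis_X n e)"
  define l where "l k = 1 / real (Suc k)" for k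
  have l: "0 < l k" "l \<longlonglongrightarrow> 0" for k
    unfolding l_def using LIMSEQ_inverse_real_of_nat by (simp_all add: inverse_eq_divide)
  have l2: "(\<lambda>k. (l k)\<^sup>2) \<longlonglongrightarrow> 0"
    using tendsto_power[OF l(2), of 2] by simp
  have L\<phi>: "?L \<phi> \<in> test_functions"
    by (intro test_sum_squares[OF divfree_heis_X[OF n e]] \<phi>) auto
  note [measurable] = test_borel[OF L\<phi>] reg_borel[OF n e]
  have "(\<lambda>k. \<integral>p. reg_G n e ((l k)\<^sup>2) p * ?L \<phi> p \<partial>lborel) \<longlonglongrightarrow> (\<integral>p. reg_G n e 0 p * ?L \<phi> p \<partial>lborel)"
  proof (rule integral_dominated_convergence)
    have "integrable lborel (\<lambda>p. reg_r n e 0 p powr (- real n) * ?L \<phi> p)"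
      by (intro locally_integrable_mult_test locally_integrable_reg_r_0[OF n e] L\<phi>) measurable
    then show "integrable lborel (\<lambda>p. sqrt 2 * \<bar>reg_r n e 0 p powr (- real n) * ?L \<phi> p\<bar>)"
      by (intro integrable_mult_right integrable_abs)
    \<comment> \<open>At the origin the majorant has the default value 0, while the regularised
      functions are positive there.\<close>
    have p0: "AE p :: (real ^ 'm) \<times> real in lborel. p \<noteq> 0"
      by (rule AE_lborel_singleton)
    show "AE p in lborel. norm (reg_G n e ((l k)\<^sup>2) p * ?L \<phi> p) \<le>
        sqrt 2 * \<bar>reg_r n e 0 p powr (- real n) * ?L \<phi> p\<bar>" for k
      using p0
    proof eventually_elim
      case (elim p)
      show ?case
        using reg_G_le[of "(l k)\<^sup>2" p] elim
          mult_right_mono[of "reg_G n e ((l k)\<^sup>2) p" "sqrt 2 * reg_r n e 0 p powr (- real n)" "\<bar>?L \<phi> p\<bar>"]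
        by (simp add: abs_mult mult.assoc)
    qed
    show "AE p in lborel. (\<lambda>k. reg_G n e ((l k)\<^sup>2) p * ?L \<phi> p) \<longlonglongrightarrow> reg_G n e 0 p * ?L \<phi> p"
      using p0 by eventually_elim (intro tendsto_mult_right reg_G_tendsto l2)
  qed measurable
  moreover have "(\<integral>p. reg_G n e ((l k)\<^sup>2) p * ?L \<phi> p \<partial>lborel) =
      - 2 * (real n - 1 / 2) * (real n + 1 / 2) * ((l k)\<^sup>2 * (\<integral>p. reg_psi n e ((l k)\<^sup>2) p * \<phi> p \<partial>lborel))" for k
  proof -
    have lk: "0 < (l k)\<^sup>2" using l(1)[of k] by simp
    have "(\<integral>p. reg_G n e ((l k)\<^sup>2) p * ?L \<phi> p \<partial>lborel) = (\<integral>p. ?L (reg_G n e ((l k)\<^sup>2)) p * \<phi> p \<partial>lborel)"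
      by (intro integral_sum_squares_by_parts[OF divfree_heis_X[OF n e]] smooth_reg[OF lk] \<phi>) auto
    also have "\<dots> = (\<integral>p. (- 2 * (real n - 1 / 2) * (real n + 1 / 2) * (l k)\<^sup>2) *
        (reg_psi n e ((l k)\<^sup>2) p * \<phi> p) \<partial>lborel)"
      unfolding lap_reg_G[OF n e lk refl] reg_psi_def by (simp only: mult_ac)
    finally show ?thesis by simp
  qed
  moreover have "(\<lambda>k. - 2 * (real n - 1 / 2) * (real n + 1 / 2) *
      ((l k)\<^sup>2 * (\<integral>p. reg_psi n e ((l k)\<^sup>2) p * \<phi> p \<partial>lborel))) \<longlonglongrightarrow>
      - 2 * (real n - 1 / 2) * (real n + 1 / 2) * (\<phi> 0 * (\<integral>p. reg_psi n e 1 p \<partial>lborel))"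
    by (intro tendsto_mult_left integral_reg_psi_tendsto \<phi> l)
  ultimately have "(\<integral>p. reg_G n e 0 p * ?L \<phi> p \<partial>lborel) =
      - 2 * (real n - 1 / 2) * (real n + 1 / 2) * (\<phi> 0 * (\<integral>p. reg_psi n e 1 p \<partial>lborel))"
    by (simp only:) (rule LIMSEQ_unique)
  then show ?thesis by (simp only: mult_ac)
qed

section \<open>The homogeneous norm\<close>

text \<open>After the factorisation of the second base, the exponent 1/2 of \<open>B + r\<close>
  cancels against the denominator. The formula also holds at the origin, where all powers have base
  0.\<close>

lemma heis_N_eq:
  "heis_N n e p = reg_r n e 0 p powr (1 / (2 * real n)) *
    (reg_a n e p + reg_r n e 0 p) powr (1 / 2 - 1 / (4 * real n)) *
    (reg_b n e 0 p + reg_r n e 0 p) powr (- (1 / (4 * real n)))"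
proof (cases "p = 0")
  case True
  then show ?thesis by (simp add: heis_N_def reg_r_def reg_b_def coord_quad_def)
next
  case False
  let ?a = "reg_a n e p" and ?b = "reg_b n e 0 p" and ?r = "reg_r n e 0 p"
  define k where "k = 1 / (4 * real n)"
  have r: "0 < ?r" and a: "0 \<le> ?a" and b: "0 \<le> ?b"
    using reg_r_0_pos[OF n e False] reg_a_nonneg[of n e p] reg_b_ge[of 0 n e p] by auto
  have B: "heis_B n e (fst p) = ?b"
    by (simp add: heis_B_eq[OF n] reg_b_def)
  have A: "heis_A n e (fst p) = ?a + ?b"
    by (simp add: heis_A_eq[OF n] reg_a_def reg_b_def coord_quad_add)
  have rr: "sqrt (?b\<^sup>2 + (snd p)\<^sup>2) = ?r" "?b\<^sup>2 + (snd p)\<^sup>2 = ?r\<^sup>2"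
    by (simp_all add: reg_r_eq)
  have fac: "(?a + ?b) * ?b + (snd p)\<^sup>2 + (?a + ?b) * ?r = (?b + ?r) * (?a + ?r)"
    using rr(2) by (simp add: algebra_simps power2_eq_square)
  have "heis_N n e p = (?r\<^sup>2) powr k * ((?b + ?r) * (?a + ?r)) powr (1 / 2 - k) / (?b + ?r) powr (1 / 2)"
    using False unfolding heis_N_def Let_def A B rr(1) unfolding rr(2) fac k_def by simp
  also have "(?r\<^sup>2) powr k = ?r powr (2 * k)"
    using r by (simp add: powr_powr flip: powr_numeral)
  also have "((?b + ?r) * (?a + ?r)) powr (1 / 2 - k) =
      (?b + ?r) powr (1 / 2 - k) * (?a + ?r) powr (1 / 2 - k)"
    using r a b by (simp add: powr_mult)
  also have "?r powr (2 * k) * ((?b + ?r) powr (1 / 2 - k) * (?a + ?r) powr (1 / 2 - k)) / (?b + ?r) powr (1 / 2)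
      = ?r powr (2 * k) * (?a + ?r) powr (1 / 2 - k) * ((?b + ?r) powr (1 / 2 - k) / (?b + ?r) powr (1 / 2))"
    by simp
  also have "(?b + ?r) powr (1 / 2 - k) / (?b + ?r) powr (1 / 2) = (?b + ?r) powr (- k)"
    by (simp flip: powr_diff)
  finally show ?thesis by (simp add: k_def)
qed

lemma heis_N_powi: "heis_N n e p powi (2 - int (hom_dim n)) = reg_G n e 0 p"
proof (cases "p = 0")
  case True
  \<comment> \<open>At the origin both sides have the default value 0, since a negative integer
    power of 0 is 0.\<close>
  then show ?thesis using n by (simp add: heis_N_def reg_G_at_0 hom_dim_def)
next
  case False
  let ?a = "reg_a n e p" and ?b = "reg_b n e 0 p" and ?r = "reg_r n e 0 p"
  have r: "0 < ?r" and a: "0 \<le> ?a" and b: "0 \<le> ?b"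
    using reg_r_0_pos[OF n e False] reg_a_nonneg[of n e p] reg_b_ge[of 0 n e p] by auto
  have pw: "(x powr c) ^ (2 * n) = x powr (c * (2 * real n))" if "0 < x" for x c :: real
    using that powr_realpow[of "x powr c" "2 * n"] by (simp add: powr_powr)
  have "2 - int (hom_dim n) = - int (2 * n)"
    by (simp add: hom_dim_def)
  then have "heis_N n e p powi (2 - int (hom_dim n)) = inverse (heis_N n e p ^ (2 * n))"
    by (simp only: power_int_minus power_int_of_nat)
  also have "heis_N n e p ^ (2 * n) = ?r powr 1 * (?a + ?r) powr (real n - 1 / 2) * (?b + ?r) powr (- (1 / 2))"
  proof -
    have "1 / (2 * real n) * (2 * real n) = 1" "(1 / 2 - 1 / (4 * real n)) * (2 * real n) = real n - 1 / 2"
      "- (1 / (4 * real n)) * (2 * real n) = - (1 / 2)"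
      using n by (simp_all add: field_simps)
    then show ?thesis
      unfolding heis_N_eq power_mult_distrib using r a b by (simp only: pw add_nonneg_pos)
  qed
  also have "inverse \<dots> = ?r powr (- 1) * (?a + ?r) powr (- (real n - 1 / 2)) * (?b + ?r) powr (- (- (1 / 2)))"
    by (simp only: powr_minus inverse_mult_distrib)
  also have "\<dots> = reg_G n e 0 p"
    by (simp only: reg_G_def reg_h_def minus_minus mult_ac)
  finally show ?thesis .
qed

lemma homogeneous_norm_heis_N: "homogeneous_norm (heis_N n e)"
proof -
  let ?a = "reg_a n e" and ?b = "reg_b n e 0" and ?r = "reg_r n e 0"
  have k: "0 < 1 / (2 * real n)" "0 < 1 / (4 * real n)" "0 < 1 / 2 - 1 / (4 * real n)"
    using n by (simp_all add: field_simps)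
  have nn: "0 \<le> ?a p" "0 \<le> ?b p" "0 \<le> ?r p" for p
    using reg_a_nonneg[of n e p] reg_b_ge[of 0 n e p] by (auto simp: reg_r_eq)
  have cont_a: "continuous_on UNIV ?a" unfolding reg_a_def by (intro smooth_continuous smooth_coord_quad)
  have cont_b: "continuous_on UNIV ?b"
    unfolding reg_b_def by (intro continuous_intros smooth_continuous smooth_coord_quad)
  have cont_r: "continuous_on UNIV ?r"
    unfolding reg_r_eq by (intro continuous_intros cont_b)
  have pos: "0 < heis_N n e p" if "p \<noteq> 0" for p
    unfolding heis_N_eq using reg_r_0_pos[OF n e that] nn[of p] by (intro mult_pos_pos) auto
  have zero: "heis_N n e 0 = 0" by (simp add: heis_N_def)
  \<comment> \<open>The negative power of b + r obstructs continuity at the origin. Replacing b + r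
    by the smaller r gives a majorant with positive exponents only, since 1/(2 n) - 1/(4 n) = 1/(4
    n); it is continuous and vanishes at 0.\<close>
  define U where "U p = ?r p powr (1 / (4 * real n)) * (?a p + ?r p) powr (1 / 2 - 1 / (4 * real n))" for p
  have U: "heis_N n e p \<le> U p" for p
  proof (cases "p = 0")
    case True
    then show ?thesis using zero by (simp add: U_def)
  next
    case False
    have r: "0 < ?r p" by (rule reg_r_0_pos[OF n e False])
    have "(?b p + ?r p) powr (- (1 / (4 * real n))) \<le> ?r p powr (- (1 / (4 * real n)))"
      using k nn[of p] r by (intro powr_mono2') auto
    then have "heis_N n e p \<le> ?r p powr (1 / (2 * real n)) * (?a p + ?r p) powr (1 / 2 - 1 / (4 * real n))
        * ?r p powr (- (1 / (4 * real n)))"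
      unfolding heis_N_eq by (intro mult_left_mono) auto
    also have "\<dots> = (?r p powr (1 / (2 * real n)) * ?r p powr (- (1 / (4 * real n))))
        * (?a p + ?r p) powr (1 / 2 - 1 / (4 * real n))"
      by (simp only: mult_ac)
    also have "?r p powr (1 / (2 * real n)) * ?r p powr (- (1 / (4 * real n))) = ?r p powr (1 / (4 * real n))"
      unfolding powr_add[symmetric] by (rule arg_cong[where f = "(powr) (?r p)"]) (simp add: field_simps)
    finally show ?thesis by (simp add: U_def)
  qed
  have "continuous_on UNIV U"
    unfolding U_def using k nn
    by (intro continuous_on_mult continuous_on_powr' continuous_on_add cont_a cont_r continuous_on_const)
      (auto simp: add_nonneg_nonneg)
  then have U_lim: "(U \<longlongrightarrow> U 0) (at 0)"
    unfolding continuous_on_eq_continuous_at[OF open_UNIV] isCont_def by blast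
  have U0: "U 0 = 0"
    by (simp add: U_def reg_r_def reg_b_def coord_quad_def)
  have "isCont (heis_N n e) p" for p
  proof (cases "p = 0")
    case True
    have "(heis_N n e \<longlongrightarrow> 0) (at 0)"
    proof (rule tendsto_sandwich[of "\<lambda>_. 0" _ _ U])
      show "\<forall>\<^sub>F p in at 0. 0 \<le> heis_N n e p"
        using pos zero by (auto intro!: always_eventually simp: less_imp_le) (metis less_imp_le order_refl)
    qed (use U U_lim U0 in auto)
    then show ?thesis by (simp add: True isCont_def zero)
  next
    case False
    have r: "0 < ?r p" by (rule reg_r_0_pos[OF n e False])
    have "isCont ?a p" "isCont ?b p" "isCont ?r p"
      using cont_a cont_b cont_r unfolding continuous_on_eq_continuous_at[OF open_UNIV] by blast+
    then show ?thesis
      unfolding heis_N_eq[abs_def] isCont_def using r nn[of p]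
      by (intro tendsto_intros) (auto simp: isCont_def)
  qed
  then have "continuous_on UNIV (heis_N n e)"
    by (simp add: continuous_on_eq_continuous_at)
  moreover have "heis_N n e (heis_dilation l p) = l * heis_N n e p" if l: "0 < l" for l p
  proof -
    have b: "?b (heis_dilation l p) = l\<^sup>2 * ?b p" and r: "?r (heis_dilation l p) = l\<^sup>2 * ?r p"
      using reg_b_dilation[of n e l 0 p] reg_r_dilation[of n e l 0 p] by simp_all
    have "heis_N n e (heis_dilation l p) = (l\<^sup>2 * ?r p) powr (1 / (2 * real n)) *
        (l\<^sup>2 * (?a p + ?r p)) powr (1 / 2 - 1 / (4 * real n)) * (l\<^sup>2 * (?b p + ?r p)) powr (- (1 / (4 * real n)))"
      unfolding heis_N_eq b r reg_a_dilation by (simp only: distrib_left)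
    also have "\<dots> = ((l\<^sup>2) powr (1 / (2 * real n)) * (l\<^sup>2) powr (1 / 2 - 1 / (4 * real n)) *
        (l\<^sup>2) powr (- (1 / (4 * real n)))) * heis_N n e p"
      unfolding heis_N_eq using nn[of p] by (simp only: powr_mult) (simp only: mult_ac)
    also have "(l\<^sup>2) powr (1 / (2 * real n)) * (l\<^sup>2) powr (1 / 2 - 1 / (4 * real n)) *
        (l\<^sup>2) powr (- (1 / (4 * real n))) = (l\<^sup>2) powr (1 / 2)"
      unfolding powr_add[symmetric] by (rule arg_cong[where f = "(powr) (l\<^sup>2)"]) (use n in \<open>simp add: field_simps\<close>)
    also have "\<dots> = l" using l by (simp add: powr_half_sqrt)
    finally show ?thesis .
  qed
  moreover have "0 \<le> heis_N n e p" "heis_N n e p = 0 \<longleftrightarrow> p = 0" for p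
    using pos[of p] zero by (cases "p = 0"; simp)+
  ultimately show ?thesis by (simp add: homogeneous_norm_def)
qed

end

theorem theorem1:
  fixes n :: nat and e :: "nat \<Rightarrow> 'm::finite"
  assumes "n \<ge> 2"
    and "bij_betw e {1..2 * n} UNIV"
  shows "homogeneous_norm (heis_N n e) \<and>
    (\<exists>c::real. c \<noteq> 0 \<and>
      locally_integrable (\<lambda>p. c * heis_N n e p powi (2 - int (hom_dim n))) \<and>
      (\<forall>\<phi>\<in>test_functions.
         sub_laplacian n e (dist_of (\<lambda>p. c * heis_N n e p powi (2 - int (hom_dim n)))) \<phi>
           = dirac 0 \<phi>))"
proof -
  have n: "1 \<le> n" using assms(1) by simp
  note e = assms(2)
  \<comment> \<open>The factor of \<open>\<phi> 0\<close> in \<open>integral_reg_G_0\<close>; the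
    required constant is its reciprocal.\<close>
  define C where "C = - 2 * (real n - 1 / 2) * (real n + 1 / 2) * (\<integral>p. reg_psi n e 1 p \<partial>lborel)"
  have C: "C \<noteq> 0"
    using n integral_reg_psi_1_pos[OF n e] by (simp add: C_def)
  have li: "locally_integrable (\<lambda>p. 1 / C * reg_G n e 0 p)"
    using locally_integrable_reg_G_0[OF n e] unfolding locally_integrable_def
    by (auto intro: set_integrable_mult_right)
  have "sub_laplacian n e (dist_of (\<lambda>p. 1 / C * reg_G n e 0 p)) \<phi> = dirac 0 \<phi>"
    if \<phi>: "\<phi> \<in> test_functions" for \<phi>
  proof -
    have "sub_laplacian n e (dist_of (\<lambda>p. 1 / C * reg_G n e 0 p)) \<phi> =
        (\<integral>p. 1 / C * reg_G n e 0 p * sum_squares {1..2 * n} (heis_X n e) \<phi> p \<partial>lborel)"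
      unfolding sub_laplacian_def using reg_borel[OF n e]
      by (intro dist_sum_squares[OF divfree_heis_X[OF n e]] li \<phi>) auto
    also have "\<dots> = 1 / C * (\<integral>p. reg_G n e 0 p * sum_squares {1..2 * n} (heis_X n e) \<phi> p \<partial>lborel)"
      by (simp only: mult.assoc integral_mult_right_zero)
    also have "\<dots> = \<phi> 0"
      unfolding integral_reg_G_0[OF n e \<phi>] C_def[symmetric] using C by simp
    finally show ?thesis by (simp add: dirac_def)
  qed
  then show ?thesis
    unfolding heis_N_powi[OF n e] using homogeneous_norm_heis_N[OF n e] li C
    by (intro conjI exI[of _ "1 / C"] ballI) simp_all
qed

end
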